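(* Let $r\ge 2$ be an integer. There exists a constant $c_r>0$ such that every graph $G$ with $m$ edges and $\lambda(G)^2 > (1-\frac{1}{r})\,2m$ satisfies $js_{r+1}(G) \ge c_r\, m^{\frac{r-1}{2}}$. Moreover, this bound is tight up to a constant factor: there exist a constant $C_r$ and, for infinitely many $m$, graphs $G$ with $m$ edges and $\lambda(G)^2 > (1-\frac{1}{r})\,2m$ satisfying $js_{r+1}(G)\le C_r\, m^{\frac{r-1}{2}}$.
   Context: All graphs are finite, simple and undirected; $\lambda(G)$ denotes the largest eigenvalue of the adjacency matrix of $G$. An $s$-joint is a family of $s$-cliques (copies of $K_s$) sharing a common edge; $js_s(G)$ is the maximum, over all edges $e$ of $G$, of the number of copies of $K_s$ in $G$ containing $e$. *)

theory Defs
  imports "Jordan_Normal_Form.Char_Poly"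
begin

(* A finite simple undirected graph is given by its order n, with vertex set {..<n},
   and its edge set E of two-element vertex sets. *)
definition simple_graph :: "nat \<Rightarrow> nat set set \<Rightarrow> bool" where
  "simple_graph n E \<longleftrightarrow> (\<forall>e\<in>E. e \<subseteq> {..<n} \<and> card e = 2)"

definition adjacency_matrix :: "nat \<Rightarrow> nat set set \<Rightarrow> real mat" where
  "adjacency_matrix n E = mat n n (\<lambda>(i, j). if {i, j} \<in> E then 1 else 0)"

(* The matrix is real symmetric, so all its eigenvalues are real.
   The graph without vertices has no eigenvalues and gets the conventional value 0. *)
definition largest_eigenvalue :: "nat \<Rightarrow> nat set set \<Rightarrow> real" where
  "largest_eigenvalue n E =
     (if n = 0 then 0 else Max {k. eigenvalue (adjacency_matrix n E) k})"

definition cliques :: "nat \<Rightarrow> nat \<Rightarrow> nat set set \<Rightarrow> nat set set" where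
  "cliques s n E =
     {S. S \<subseteq> {..<n} \<and> card S = s \<and> (\<forall>u\<in>S. \<forall>v\<in>S. u \<noteq> v \<longrightarrow> {u, v} \<in> E)}"

(* Maximum over the edges; 0 by convention if there are none. *)
definition js :: "nat \<Rightarrow> nat \<Rightarrow> nat set set \<Rightarrow> nat" where
  "js s n E =
     (if E = {} then 0 else Max ((\<lambda>e. card {S \<in> cliques s n E. e \<subseteq> S}) ` E))"

end

theory Submission
  imports Defs "HOL-Analysis.Function_Topology" "HOL-Analysis.Convex"
begin

text \<open>
  Write \<open>q = 1 - 1/r\<close>. Among all edge subsets \<open>F\<close> of \<open>G\<close> and unit vectors \<open>x \<ge> 0\<close> maximize
  \<open>(x\<^sup>T A\<^sub>F x)\<^sup>2 - 2 q (1 - \<eta>) |F|\<close>. The maximizing \<open>F\<close> still satisfies the spectral hypothesis and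
  keeps a positive proportion of the edges, \<open>x\<close> is its Perron vector, with eigenvalue \<open>\<rho>\<close>, and
  comparison with the deletion of an edge or of a vertex shows, for the weights \<open>w = x\<^sup>2\<close> of total
  mass 1, that \<open>w\<^sub>i w\<^sub>j \<ge> const / \<rho>\<^sup>2\<close> on edges, that the degree of \<open>v\<close> is at most about
  \<open>\<rho>\<^sup>2 w\<^sub>v / q\<close> and hence, by Cauchy--Schwarz, that every neighbourhood has weight almost \<open>q\<close>.
  The Motzkin--Straus inequality provides a \<open>K\<^sub>r\<^sub>+\<^sub>1\<close> in \<open>F\<close>.

  If all weights are \<open>O(1/\<rho>)\<close>, convexity yields two vertices of this clique whose common
  neighbourhood has weight at least \<open>1 - 2/r + const\<close>; then any clique on at most \<open>r\<close> vertices
  containing these two has a common neighbourhood of weight bounded below, that is, of size at least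
  \<open>const \<rho>\<close>, and extending greedily gives the joint. If some weight is much larger
  than \<open>1/\<rho>\<close>, then few heavy vertices carry weight almost \<open>q\<close>. This is impossible for \<open>r \<ge> 3\<close>, and
  for \<open>r = 2\<close> the graph is close to an unbalanced complete bipartite graph, in which some edge of the
  triangle joins two vertices that both see most of the light vertices.

  Complete graphs show that the order of magnitude is right.
\<close>

section \<open>Quadratic form of the adjacency matrix\<close>

definition nbh :: "nat set set \<Rightarrow> nat \<Rightarrow> nat set" where
  "nbh E v = {u. {v, u} \<in> E}"

text \<open>The value \<open>x^T A y\<close>, summed over ordered pairs: an edge enters
  \<open>bform n E x x\<close> once per orientation, matching the factor 2 in
  \<open>2 * card E\<close>.\<close>

definition bform :: "nat \<Rightarrow> nat set set \<Rightarrow> (nat \<Rightarrow> real) \<Rightarrow> (nat \<Rightarrow> real) \<Rightarrow> real" where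
  "bform n E x y = (\<Sum>i<n. \<Sum>j<n. of_bool ({i, j} \<in> E) * (x i * y j))"

text \<open>Nonnegativity is asked of all indices, not only those below \<open>n\<close>, so that
  \<open>bform_nonneg\<close> applies without index bounds.\<close>

abbreviation unit_nonneg :: "nat \<Rightarrow> (nat \<Rightarrow> real) \<Rightarrow> bool" where
  "unit_nonneg n x \<equiv> (\<forall>i. 0 \<le> x i) \<and> (\<Sum>i<n. (x i)\<^sup>2) = 1"

lemma simple_graph_finite: "simple_graph n E \<Longrightarrow> finite E"
  by (rule finite_subset[of _ "Pow {..<n}"]) (auto simp: simple_graph_def)

lemma simple_graph_subset: "simple_graph n E \<Longrightarrow> F \<subseteq> E \<Longrightarrow> simple_graph n F"
  by (auto simp: simple_graph_def)

lemma nbh_less: "simple_graph n E \<Longrightarrow> u \<in> nbh E v \<Longrightarrow> u < n"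
  by (auto simp: simple_graph_def nbh_def)

lemma nbh_subset: "simple_graph n E \<Longrightarrow> nbh E v \<subseteq> {..<n}"
  using nbh_less by blast

lemma finite_nbh: "simple_graph n E \<Longrightarrow> finite (nbh E v)"
  by (rule finite_subset[OF nbh_subset]) auto

lemma nbh_irrefl: "simple_graph n E \<Longrightarrow> v \<notin> nbh E v"
  by (auto simp: simple_graph_def nbh_def)

lemma card_edges_at:
  assumes "simple_graph n E"
  shows "card {e \<in> E. v \<in> e} = card (nbh E v)"
proof -
  have "{e \<in> E. v \<in> e} = (\<lambda>u. {v, u}) ` nbh E v"
  proof (rule equalityI; rule subsetI)
    fix e assume "e \<in> {e \<in> E. v \<in> e}"
    then have e: "e \<in> E" "v \<in> e" "card e = 2"
      using assms by (auto simp: simple_graph_def)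
    then obtain a b where "e = {a, b}" by (meson card_2_iff)
    with e show "e \<in> (\<lambda>u. {v, u}) ` nbh E v"
      by (auto simp: nbh_def insert_commute)
  qed (auto simp: nbh_def)
  moreover have "inj_on (\<lambda>u. {v, u}) (nbh E v)"
    by (auto simp: inj_on_def doubleton_eq_iff)
  ultimately show ?thesis by (simp add: card_image)
qed

lemma handshake:
  assumes "simple_graph n E"
  shows "(\<Sum>v<n. card (nbh E v)) = 2 * card E"
proof -
  have "(\<Sum>v<n. card (nbh E v)) = (\<Sum>v<n. card {e \<in> E. v \<in> e})"
    by (simp add: card_edges_at[OF assms])
  also have "\<dots> = 2 * card E"
  proof (rule sum_multicount)
    show "\<forall>e\<in>E. card {v \<in> {..<n}. v \<in> e} = 2"
    proof
      fix e assume "e \<in> E"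
      then have "e \<subseteq> {..<n}" "card e = 2" using assms by (auto simp: simple_graph_def)
      moreover from this have "{v \<in> {..<n}. v \<in> e} = e" by auto
      ultimately show "card {v \<in> {..<n}. v \<in> e} = 2" by simp
    qed
  qed (use assms simple_graph_finite in auto)
  finally show ?thesis .
qed

lemma sum_of_bool_nbh:
  fixes y :: "nat \<Rightarrow> real"
  assumes "simple_graph n E"
  shows "(\<Sum>j<n. of_bool ({i, j} \<in> E) * y j) = sum y (nbh E i)"
proof -
  have "nbh E i = {j \<in> {..<n}. {i, j} \<in> E}"
    using nbh_subset[OF assms] by (auto simp: nbh_def)
  then show ?thesis
    by (simp add: of_bool_def if_distrib[of "\<lambda>b. b * _"] sum.If_cases Collect_conj_eq lessThan_def Int_commute cong: if_cong)
qed

lemma bform_nbh: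
  assumes "simple_graph n E"
  shows "bform n E x y = (\<Sum>i<n. x i * sum y (nbh E i))"
  unfolding bform_def sum_of_bool_nbh[OF assms, symmetric] sum_distrib_left
  by (intro sum.cong refl) (simp only: mult_ac)

lemma bform_sym: "bform n E x y = bform n E y x"
  unfolding bform_def by (subst sum.swap) (simp add: insert_commute mult_ac)

lemma bform_add_scaled:
  "bform n E (\<lambda>i. x i + t * z i) (\<lambda>i. x i + t * z i)
     = bform n E x x + 2 * t * bform n E z x + t\<^sup>2 * bform n E z z"
proof -
  have "bform n E (\<lambda>i. x i + t * z i) (\<lambda>i. x i + t * z i)
      = bform n E x x + t * bform n E z x + t * bform n E x z + t\<^sup>2 * bform n E z z"
    unfolding bform_def
    by (simp add: sum_distrib_left sum.distrib[symmetric] algebra_simps power2_eq_square)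
  then show ?thesis by (simp add: bform_sym[of n E x z])
qed

lemma bform_scale: "bform n E (\<lambda>i. c * x i) (\<lambda>i. c * x i) = c\<^sup>2 * bform n E x x"
  unfolding bform_def by (simp add: sum_distrib_left power2_eq_square mult_ac)

lemma bform_nonneg: "(\<And>i. 0 \<le> x i) \<Longrightarrow> (\<And>i. 0 \<le> y i) \<Longrightarrow> 0 \<le> bform n E x y"
  unfolding bform_def by (intro sum_nonneg) auto

lemma bform_abs: "\<bar>bform n E x x\<bar> \<le> bform n E (\<lambda>i. \<bar>x i\<bar>) (\<lambda>i. \<bar>x i\<bar>)"
proof -
  have "\<bar>bform n E x x\<bar> \<le> (\<Sum>i<n. \<Sum>j<n. \<bar>of_bool ({i, j} \<in> E) * (x i * x j)\<bar>)"
    unfolding bform_def by (intro order_trans[OF sum_abs] sum_mono) auto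
  then show ?thesis by (simp add: bform_def abs_mult)
qed

lemma sum_single: "v < (n::nat) \<Longrightarrow> (\<Sum>i<n. of_bool (i = v) * f i) = (f v :: real)"
  by (subst sum.remove[of "{..<n}" v]) (auto intro!: sum.neutral)

lemma bform_unit:
  assumes "simple_graph n E" "v < n"
  shows "bform n E (\<lambda>i. of_bool (i = v)) x = sum x (nbh E v)"
  using sum_single[OF assms(2)] by (simp add: bform_nbh[OF assms(1)])

lemma bform_unit_unit:
  assumes "simple_graph n E" "v < n"
  shows "bform n E (\<lambda>i. of_bool (i = v)) (\<lambda>i. of_bool (i = v)) = 0"
  using nbh_irrefl[OF assms(1), of v]
  by (subst bform_unit[OF assms]) (auto intro!: sum.neutral simp: of_bool_def)

section \<open>Maximizers of the Rayleigh quotient\<close>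

lemma linear_term_zero:
  fixes b c :: real
  assumes "\<And>t. 2 * t * b + t\<^sup>2 * c \<le> 0"
  shows "b = 0"
proof (rule ccontr)
  assume "b \<noteq> 0"
  \<comment> \<open>At this \<open>t = s\<close> the linear term equals
    \<open>2 * s\<^sup>2 * (\<bar>c\<bar> + 1)\<close> and outweighs the quadratic one.\<close>
  define s where "s = b / (\<bar>c\<bar> + 1)"
  have sb: "b = s * (\<bar>c\<bar> + 1)" by (simp add: s_def)
  have "s \<noteq> 0" using \<open>b \<noteq> 0\<close> by (simp add: s_def)
  have "2 * s * b + s\<^sup>2 * c = s\<^sup>2 * (2 * \<bar>c\<bar> + 2 + c)"
    by (subst sb) (simp add: algebra_simps power2_eq_square)
  moreover have "\<dots> > 0" using \<open>s \<noteq> 0\<close> by (intro mult_pos_pos) auto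
  ultimately show False using assms[of s] by simp
qed

text \<open>At a maximizer of the Rayleigh quotient the first variation in the direction of the
  coordinate \<open>v\<close> vanishes; this is row \<open>v\<close> of the eigenvalue
  equation.\<close>

lemma rayleigh_eigen:
  assumes G: "simple_graph n E" and x: "(\<Sum>i<n. (x i)\<^sup>2) = 1" and v: "v < n"
    and max: "\<And>y. bform n E y y \<le> bform n E x x * (\<Sum>i<n. (y i)\<^sup>2)"
  shows "sum x (nbh E v) = bform n E x x * x v"
proof -
  let ?\<rho> = "bform n E x x" and ?z = "\<lambda>i. of_bool (i = v) :: real"
  have "sum x (nbh E v) - ?\<rho> * x v = 0"
  proof (rule linear_term_zero[of _ "- ?\<rho>"])
    fix t :: real
    have "(\<Sum>i<n. (x i + t * ?z i)\<^sup>2) = (\<Sum>i<n. (x i)\<^sup>2) + 2 * t * (\<Sum>i<n. ?z i * x i) + t\<^sup>2 * (\<Sum>i<n. ?z i * 1)"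
      unfolding sum_distrib_left sum.distrib[symmetric]
      by (intro sum.cong refl) (auto simp: power2_eq_square algebra_simps)
    also have "\<dots> = 1 + 2 * t * x v + t\<^sup>2"
      using sum_single[OF v, of x] sum_single[OF v, of "\<lambda>_. 1"] x by simp
    finally have "?\<rho> + 2 * t * sum x (nbh E v) \<le> ?\<rho> * (1 + 2 * t * x v + t\<^sup>2)"
      using max[of "\<lambda>i. x i + t * ?z i"]
      unfolding bform_add_scaled bform_unit_unit[OF G v] bform_unit[OF G v] by simp
    then show "2 * t * (sum x (nbh E v) - ?\<rho> * x v) + t\<^sup>2 * - ?\<rho> \<le> 0"
      by (simp add: algebra_simps)
  qed
  then show ?thesis by simp
qed

text \<open>Compactness gives a maximizer on the nonnegative part of the sphere. Passing from
  \<open>y\<close> to its absolute values can only increase the form, so this maximizer beats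
  vectors of all signs.\<close>

lemma rayleigh_max_exists:
  assumes "n > 0"
  obtains x where "unit_nonneg n x" "\<And>y. \<bar>bform n E y y\<bar> \<le> bform n E x x * (\<Sum>i<n. (y i)\<^sup>2)"
proof -
  \<comment> \<open>Coordinates from \<open>n\<close> on are pinned to 0, which makes
    \<open>B\<close> a product of compact sets in the space of all functions.\<close>
  define B :: "(nat \<Rightarrow> real) set" where "B = PiE UNIV (\<lambda>i. if i < n then {0..1} else {0})"
  define S where "S = B \<inter> {x. (\<Sum>i<n. (x i)\<^sup>2) = 1}"
  have coord: "continuous_on X (\<lambda>x::nat \<Rightarrow> real. x i)" for i X
    by (rule continuous_on_subset[OF continuous_on_product_coordinates]) auto
  have "compactin (product_topology (\<lambda>_. euclidean) UNIV) B"
    unfolding B_def by (subst compactin_PiE) auto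
  then have "compact B" by (simp add: euclidean_product_topology)
  moreover have "closed {x::nat \<Rightarrow> real. (\<Sum>i<n. (x i)\<^sup>2) = 1}"
    by (intro closed_Collect_eq continuous_intros coord)
  ultimately have "compact S" unfolding S_def by (rule compact_Int_closed)
  moreover have "(\<lambda>i. of_bool (i = 0)) \<in> S"
    using sum_single[OF assms, of "\<lambda>_. 1"] assms
    by (auto simp: S_def B_def PiE_def of_bool_def if_distrib[of "\<lambda>b. b ^ 2"] cong: if_cong)
  then have "S \<noteq> {}" by blast
  moreover have "continuous_on S (\<lambda>x. bform n E x x)"
    unfolding bform_def by (intro continuous_intros coord)
  ultimately obtain x where xS: "x \<in> S" and mx: "\<And>y. y \<in> S \<Longrightarrow> bform n E y y \<le> bform n E x x"
    using continuous_attains_sup[of S "\<lambda>x. bform n E x x"] by blast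
  have x: "unit_nonneg n x"
    using xS by (auto simp: S_def B_def PiE_def Pi_def split: if_splits)
  show ?thesis
  proof (rule that[OF x])
    fix y :: "nat \<Rightarrow> real"
    define s where "s = (\<Sum>i<n. (y i)\<^sup>2)"
    have "s \<ge> 0" unfolding s_def by (intro sum_nonneg) auto
    show "\<bar>bform n E y y\<bar> \<le> bform n E x x * (\<Sum>i<n. (y i)\<^sup>2)"
    proof (cases "s = 0")
      case True
      then have "\<And>i. i < n \<Longrightarrow> y i = 0" by (auto simp: s_def sum_nonneg_eq_0_iff)
      then have "bform n E y y = 0" by (simp add: bform_def)
      with True show ?thesis by (simp add: s_def)
    next
      case False
      with \<open>s \<ge> 0\<close> have "s > 0" by simp
      \<comment> \<open>The normalized absolute value of \<open>y\<close>, cut off at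
        \<open>n\<close> so that it lies in \<open>S\<close>.\<close>
      define z where "z = (\<lambda>i. if i < n then (1 / sqrt s) * \<bar>y i\<bar> else 0)"
      have z1: "(\<Sum>i<n. (z i)\<^sup>2) = 1"
        using \<open>s > 0\<close> by (simp add: z_def power_mult_distrib power_divide sum_divide_distrib[symmetric] s_def[symmetric])
      have "z i \<le> 1" if "i < n" for i
      proof -
        have "(z i)\<^sup>2 \<le> (\<Sum>i<n. (z i)\<^sup>2)" using that by (intro member_le_sum) auto
        then show ?thesis using z1 by (simp add: power2_le_iff_abs_le abs_square_le_1)
      qed
      then have "z \<in> S" using z1 \<open>s > 0\<close>
        by (auto simp: S_def B_def PiE_def) (auto simp: z_def)
      from mx[OF this] have "bform n E z z \<le> bform n E x x" .
      moreover have "bform n E z z = bform n E (\<lambda>i. (1 / sqrt s) * \<bar>y i\<bar>) (\<lambda>i. (1 / sqrt s) * \<bar>y i\<bar>)"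
        unfolding bform_def z_def by (intro sum.cong) auto
      then have "bform n E z z = bform n E (\<lambda>i. \<bar>y i\<bar>) (\<lambda>i. \<bar>y i\<bar>) / s"
        unfolding bform_scale using \<open>s > 0\<close> by (simp add: power_divide)
      ultimately have "bform n E (\<lambda>i. \<bar>y i\<bar>) (\<lambda>i. \<bar>y i\<bar>) \<le> bform n E x x * s"
        using \<open>s > 0\<close> by (simp add: field_simps)
      then show ?thesis using bform_abs[of n E y] by (simp add: s_def)
    qed
  qed
qed

section \<open>From the quadratic form to the eigenvalues of the matrix\<close>

lemma adjacency_mult_vec:
  assumes "simple_graph n E" "v \<in> carrier_vec n" "i < n"
  shows "(adjacency_matrix n E *\<^sub>v v) $ i = sum (($) v) (nbh E i)"
proof -
  have "(adjacency_matrix n E *\<^sub>v v) $ i = (\<Sum>j<n. of_bool ({i, j} \<in> E) * v $ j)"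
    using assms by (simp add: adjacency_matrix_def scalar_prod_def of_bool_def lessThan_atLeast0 cong: if_cong)
  then show ?thesis by (simp add: sum_of_bool_nbh[OF assms(1)])
qed

lemma eigenvalue_adjacencyI:
  assumes "simple_graph n E" "\<And>i. i < n \<Longrightarrow> sum x (nbh E i) = k * x i" "j < n" "x j \<noteq> 0"
  shows "eigenvalue (adjacency_matrix n E) k"
proof -
  let ?v = "vec n x"
  have "sum (($) ?v) (nbh E i) = sum x (nbh E i)" for i
    using nbh_less[OF assms(1)] by (intro sum.cong) auto
  then have "adjacency_matrix n E *\<^sub>v ?v = k \<cdot>\<^sub>v ?v"
    using adjacency_mult_vec[OF assms(1), of ?v] assms(2)
    by (intro eq_vecI) (auto simp: adjacency_matrix_def)
  moreover have "?v \<noteq> 0\<^sub>v n" using assms(3,4) by (metis index_vec index_zero_vec(1))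
  ultimately show ?thesis
    unfolding eigenvalue_def eigenvector_def
    by (intro exI[of _ ?v]) (auto simp: adjacency_matrix_def)
qed

text \<open>Makes the \<open>Max\<close> in \<open>largest_eigenvalue\<close> meaningful:
  eigenvalues are roots of the monic, hence nonzero, characteristic polynomial.\<close>

lemma finite_eigenvalues_adjacency: "finite {k. eigenvalue (adjacency_matrix n E) k}"
proof -
  have A: "adjacency_matrix n E \<in> carrier_mat n n" by (simp add: adjacency_matrix_def)
  have "char_poly (adjacency_matrix n E) \<noteq> 0" using degree_monic_char_poly[OF A] by auto
  then show ?thesis using poly_roots_finite by (simp add: eigenvalue_root_char_poly[OF A])
qed

text \<open>The Rayleigh maximizer is an eigenvector, so the set of eigenvalues is nonempty and its
  \<open>Max\<close> is attained. Testing the Rayleigh bound on an eigenvector for that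
  \<open>Max\<close> gives the inequality.\<close>

lemma largest_eigenvalue_le_rayleigh:
  assumes G: "simple_graph n E" and "n > 0"
  obtains x where "unit_nonneg n x" "\<bar>largest_eigenvalue n E\<bar> \<le> bform n E x x"
proof -
  obtain x where x: "unit_nonneg n x"
    and max: "\<And>y. \<bar>bform n E y y\<bar> \<le> bform n E x x * (\<Sum>i<n. (y i)\<^sup>2)"
    using rayleigh_max_exists[OF assms(2)] by metis
  let ?K = "{k. eigenvalue (adjacency_matrix n E) k}"
  have "\<exists>j<n. x j \<noteq> 0"
  proof (rule ccontr)
    assume "\<not> ?thesis"
    then have "(\<Sum>i<n. (x i)\<^sup>2) = 0" by (intro sum.neutral) auto
    with x show False by simp
  qed
  then have "bform n E x x \<in> ?K"
    using eigenvalue_adjacencyI[OF G rayleigh_eigen[OF G]] x max abs_le_D1 by blast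
  then have "Max ?K \<in> ?K" using finite_eigenvalues_adjacency Max_in by blast
  then obtain v where v: "v \<in> carrier_vec n" "v \<noteq> 0\<^sub>v n"
    "adjacency_matrix n E *\<^sub>v v = largest_eigenvalue n E \<cdot>\<^sub>v v"
    using \<open>n > 0\<close> unfolding mem_Collect_eq eigenvalue_def[of _ "Max _"] eigenvector_def
    by (auto simp: largest_eigenvalue_def adjacency_matrix_def)
  define y where "y = ($) v"
  have "bform n E y y = (\<Sum>i<n. y i * (largest_eigenvalue n E * y i))"
    unfolding bform_nbh[OF G] y_def
    using adjacency_mult_vec[OF G v(1)] v by (intro sum.cong) auto
  then have "bform n E y y = largest_eigenvalue n E * (\<Sum>i<n. (y i)\<^sup>2)"
    by (simp add: sum_distrib_left power2_eq_square mult_ac)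
  then have "\<bar>largest_eigenvalue n E\<bar> * (\<Sum>i<n. (y i)\<^sup>2) \<le> bform n E x x * (\<Sum>i<n. (y i)\<^sup>2)"
    using max[of y] by (simp add: abs_mult sum_nonneg)
  moreover have "(\<Sum>i<n. (y i)\<^sup>2) > 0"
  proof -
    from v(1,2) obtain i where "i < n" "y i \<noteq> 0" unfolding y_def by (metis eq_vecI carrier_vecD index_zero_vec)
    then show ?thesis by (intro sum_pos2[of _ i]) auto
  qed
  ultimately show ?thesis using that[OF x] by simp
qed

section \<open>The Motzkin--Straus inequality\<close>

lemma sum_squared_le_card:
  fixes f :: "'a \<Rightarrow> real"
  shows "(sum f I)\<^sup>2 \<le> real (card I) * (\<Sum>i\<in>I. (f i)\<^sup>2)"
  using sum_squared_le_sum_of_squares[of f I] by (simp add: mult.commute)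

text \<open>Cauchy--Schwarz over the \<open>2 * card E\<close> ordered adjacent pairs; it replaces
  the vector \<open>x\<close> by the weights \<open>x\<^sup>2\<close> of total mass 1.\<close>

lemma bform_squared_le:
  assumes G: "simple_graph n E"
  shows "(bform n E x x)\<^sup>2 \<le> 2 * real (card E) * bform n E (\<lambda>i. (x i)\<^sup>2) (\<lambda>i. (x i)\<^sup>2)"
proof -
  let ?D = "SIGMA i:{..<n}. nbh E i"
  have fin: "\<forall>i\<in>{..<n}. finite (nbh E i)" using finite_nbh[OF G] by blast
  have b: "bform n E y y = (\<Sum>(i, j)\<in>?D. y i * y j)" for y
    by (simp add: bform_nbh[OF G] sum_distrib_left sum.Sigma fin)
  have "card ?D = 2 * card E"
    using handshake[OF G] by (simp add: card_SigmaI fin)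
  moreover have "(\<Sum>(i, j)\<in>?D. x i * x j)\<^sup>2 \<le> real (card ?D) * (\<Sum>(i, j)\<in>?D. (x i)\<^sup>2 * (x j)\<^sup>2)"
    using sum_squared_le_card[of "\<lambda>(i, j). x i * x j" ?D]
    by (simp add: case_prod_beta power_mult_distrib)
  ultimately show ?thesis unfolding b by simp
qed

text \<open>The right-hand side is the form of the complete graph.\<close>

lemma bform_le_sum_squared:
  assumes "simple_graph n E" "\<And>i. 0 \<le> w i"
  shows "bform n E w w \<le> (\<Sum>i<n. w i)\<^sup>2 - (\<Sum>i<n. (w i)\<^sup>2)"
proof -
  have "bform n E w w \<le> (\<Sum>i<n. w i * (\<Sum>j\<in>{..<n} - {i}. w j))"
    unfolding bform_nbh[OF assms(1)]
    using nbh_subset[OF assms(1)] nbh_irrefl[OF assms(1)] assms(2)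
    by (intro sum_mono mult_left_mono sum_mono2) auto
  also have "\<dots> = (\<Sum>i<n. w i * ((\<Sum>j<n. w j) - w i))"
    by (intro sum.cong refl) (simp add: sum_diff1)
  also have "\<dots> = (\<Sum>i<n. w i)\<^sup>2 - (\<Sum>i<n. (w i)\<^sup>2)"
    by (simp add: power2_eq_square right_diff_distrib sum_subtractf sum_distrib_right)
  finally show ?thesis .
qed

text \<open>Shifting all the weight of one of two non-adjacent vertices to the other one changes the form
  by a linear amount, so one of the two directions does not decrease it; repeating this
  concentrates the weight on a clique.\<close>

lemma motzkin_straus:
  assumes G: "simple_graph n E" and "\<And>i. 0 \<le> w i" "(\<Sum>i<n. w i) = 1"
  shows "\<exists>S. S \<in> cliques (card S) n E \<and> S \<noteq> {} \<and> bform n E w w \<le> 1 - 1 / card S"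
  using assms(2,3)
proof (induction "card {i \<in> {..<n}. w i \<noteq> 0}" arbitrary: w rule: less_induct)
  case less
  define T where "T = {i \<in> {..<n}. w i \<noteq> 0}"
  have T: "finite T" "T \<subseteq> {..<n}" by (auto simp: T_def)
  have sT: "sum w T = 1"
    using less.prems(2) unfolding T_def by (subst sum.mono_neutral_left[of "{..<n}"]) auto
  show ?case
  proof (cases "\<forall>u\<in>T. \<forall>v\<in>T. u \<noteq> v \<longrightarrow> {u, v} \<in> E")
    case True
    have "T \<noteq> {}" using sT by auto
    have "(\<Sum>i<n. (w i)\<^sup>2) = (\<Sum>i\<in>T. (w i)\<^sup>2)"
      unfolding T_def by (rule sum.mono_neutral_right) auto
    moreover have "1 \<le> real (card T) * (\<Sum>i\<in>T. (w i)\<^sup>2)"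
      using sum_squared_le_card[of w T] sT by simp
    then have "1 / real (card T) \<le> (\<Sum>i\<in>T. (w i)\<^sup>2)"
      using \<open>T \<noteq> {}\<close> T by (simp add: field_simps card_gt_0_iff)
    ultimately have "bform n E w w \<le> 1 - 1 / card T"
      using bform_le_sum_squared[OF G, of w] less.prems(1) less.prems(2) by simp
    moreover have "T \<in> cliques (card T) n E" using True T by (auto simp: cliques_def)
    ultimately show ?thesis using \<open>T \<noteq> {}\<close> by blast
  next
    case False
    then obtain a b where "a \<in> T" "b \<in> T" "a \<noteq> b" "{a, b} \<notin> E" by blast
    \<comment> \<open>Of the two non-adjacent vertices, \<open>i\<close> is the one with the larger
      neighbour sum; the weight of \<open>j\<close> moves to \<open>i\<close>.\<close>
    then have "\<exists>i j. i \<in> T \<and> j \<in> T \<and> i \<noteq> j \<and> {i, j} \<notin> E \<and> sum w (nbh E j) \<le> sum w (nbh E i)"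
      by (metis insert_commute linear)
    then obtain i j where ij: "i \<in> T" "j \<in> T" "i \<noteq> j" "{i, j} \<notin> E"
      and le: "sum w (nbh E j) \<le> sum w (nbh E i)" by blast
    then have n: "i < n" "j < n" by (auto simp: T_def)
    define z :: "nat \<Rightarrow> real" where "z = (\<lambda>k. of_bool (k = i) - of_bool (k = j))"
    define w' where "w' = (\<lambda>k. w k + w j * z k)"
    have z: "bform n E z y = sum y (nbh E i) - sum y (nbh E j)" for y
      using sum_single[OF n(1)] sum_single[OF n(2)]
      by (simp add: bform_nbh[OF G] z_def left_diff_distrib sum_subtractf)
    \<comment> \<open>Non-adjacency of \<open>i\<close> and \<open>j\<close> kills the quadratic
      term, so the change in the form is linear.\<close>
    have zn: "sum z (nbh E i) = 0" "sum z (nbh E j) = 0"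
      using ij nbh_irrefl[OF G] by (auto intro!: sum.neutral simp: z_def nbh_def insert_commute)
    have "bform n E w' w' = bform n E w w + 2 * w j * (sum w (nbh E i) - sum w (nbh E j))"
      unfolding w'_def bform_add_scaled z zn by simp
    moreover have "w j * (sum w (nbh E i) - sum w (nbh E j)) \<ge> 0"
      using le less.prems(1) by simp
    ultimately have ge: "bform n E w w \<le> bform n E w' w'" by simp
    have w'0: "0 \<le> w' k" for k
      using less.prems(1)[of k] less.prems(1)[of j] ij by (auto simp: w'_def z_def)
    have "(\<Sum>k<n. z k) = 0"
      using sum_single[OF n(1), of "\<lambda>_. 1"] sum_single[OF n(2), of "\<lambda>_. 1"]
      by (simp add: z_def sum_subtractf)
    then have "(\<Sum>k<n. w' k) = 1"
      using less.prems(2) by (simp add: w'_def sum.distrib sum_distrib_left[symmetric])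
    \<comment> \<open>The support loses \<open>j\<close> and gains nothing, as \<open>i\<close>
      already belonged to it.\<close>
    moreover have "card {k \<in> {..<n}. w' k \<noteq> 0} < card {k \<in> {..<n}. w k \<noteq> 0}"
    proof (rule psubset_card_mono)
      have "w' j = 0" using ij by (simp add: w'_def z_def)
      moreover have "w' k = 0" if "w k = 0" "k < n" for k
        using that ij by (auto simp: w'_def z_def T_def)
      ultimately show "{k \<in> {..<n}. w' k \<noteq> 0} \<subset> {k \<in> {..<n}. w k \<noteq> 0}"
        using ij by (auto simp: T_def)
    qed simp
    ultimately obtain S where "S \<in> cliques (card S) n E" "S \<noteq> {}" "bform n E w' w' \<le> 1 - 1 / card S"
      using less.hyps w'0 by blast
    with ge show ?thesis by (meson order_trans)
  qed
qed

text \<open>Cauchy--Schwarz and Motzkin--Straus together bound the squared form by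
  \<open>(1 - 1/s) * 2m\<close> for the size \<open>s\<close> of some clique; the strict hypothesis
  then forces \<open>s > r\<close>.\<close>

lemma clique_exists_of_large_form:
  assumes G: "simple_graph n E" and x: "unit_nonneg n x" and "r > 0"
    and large: "(bform n E x x)\<^sup>2 > (1 - 1 / real r) * (2 * real (card E))"
  obtains K where "K \<in> cliques (r + 1) n E"
proof -
  let ?w = "\<lambda>i. (x i)\<^sup>2"
  obtain S where S: "S \<in> cliques (card S) n E" "S \<noteq> {}" "bform n E ?w ?w \<le> 1 - 1 / card S"
    using motzkin_straus[OF G, of ?w] x by auto
  have fS: "finite S" using S(1) finite_subset[of S "{..<n}"] by (auto simp: cliques_def)
  have "(1 - 1 / real r) * (2 * real (card E)) < (1 - 1 / card S) * (2 * real (card E))"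
    using large bform_squared_le[OF G, of x] mult_right_mono[OF S(3), of "2 * real (card E)"]
    by (simp add: mult_ac)
  then have "1 - 1 / real r < 1 - 1 / card S"
    by (rule mult_right_less_imp_less) simp
  then have "1 / real (card S) < 1 / real r" by simp
  moreover have "card S > 0" using fS S(2) by (simp add: card_gt_0_iff)
  ultimately have "r + 1 \<le> card S" using \<open>r > 0\<close> by (simp add: field_simps)
  then obtain K where "K \<subseteq> S" "card K = r + 1" by (rule obtain_subset_with_card_n)
  with S(1) have "K \<in> cliques (r + 1) n E" by (auto simp: cliques_def)
  then show ?thesis by (rule that)
qed

section \<open>Deleting edges and vertices\<close>

lemma bform_remove_edge:
  assumes "simple_graph n E" "{a, b} \<in> E" "\<And>i. 0 \<le> x i"
  shows "bform n E x x - 2 * (x a * x b) \<le> bform n (E - {{a, b}}) x x"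
proof -
  have ab: "a < n" "b < n" "a \<noteq> b" using assms by (auto simp: simple_graph_def)
  have "of_bool ({i, j} \<in> E) * (x i * x j) \<le> of_bool ({i, j} \<in> E - {{a, b}}) * (x i * x j)
      + of_bool (i = a) * (of_bool (j = b) * (x a * x b)) + of_bool (i = b) * (of_bool (j = a) * (x a * x b))" for i j
    using assms(3)[of i] assms(3)[of j] by (auto simp: doubleton_eq_iff)
  then have "bform n E x x \<le> (\<Sum>i<n. \<Sum>j<n. of_bool ({i, j} \<in> E - {{a, b}}) * (x i * x j)
      + of_bool (i = a) * (of_bool (j = b) * (x a * x b)) + of_bool (i = b) * (of_bool (j = a) * (x a * x b)))"
    unfolding bform_def by (intro sum_mono)
  also have "\<dots> = bform n (E - {{a, b}}) x x + 2 * (x a * x b)"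
    unfolding bform_def sum.distrib sum_distrib_left[symmetric] sum_single[OF ab(1)] sum_single[OF ab(2)]
    by simp
  finally show ?thesis by simp
qed

text \<open>Zeroing a coordinate subtracts \<open>x v\<close> times a unit vector: the cross term is
  evaluated by the eigenvalue equation, and the diagonal term is 0 because there are no
  loops.\<close>

lemma bform_remove_vertex:
  assumes G: "simple_graph n E" and v: "v < n" and eig: "sum x (nbh E v) = \<rho> * x v"
  shows "bform n {e \<in> E. v \<notin> e} (x(v := 0)) (x(v := 0)) = bform n E x x - 2 * \<rho> * (x v)\<^sup>2"
proof -
  have "bform n {e \<in> E. v \<notin> e} (x(v := 0)) (x(v := 0)) = bform n E (x(v := 0)) (x(v := 0))"
    unfolding bform_def by (intro sum.cong refl) auto
  also have "\<dots> = bform n E (\<lambda>i. x i + (- x v) * of_bool (i = v)) (\<lambda>i. x i + (- x v) * of_bool (i = v))"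
    unfolding bform_def by (intro sum.cong refl) auto
  also have "\<dots> = bform n E x x - 2 * \<rho> * (x v)\<^sup>2"
    unfolding bform_add_scaled bform_unit_unit[OF G v] bform_unit[OF G v] eig
    by (simp add: power2_eq_square)
  finally show ?thesis .
qed

text \<open>Here \<open>c\<close> is a price per edge. Choosing a Rayleigh maximizer
  \<open>X F\<close> for each \<open>F\<close> reduces the joint optimization to a finite one over
  \<open>Pow E\<close>.\<close>

lemma charged_maximizer_exists:
  assumes G: "simple_graph n E" and "n > 0"
  obtains F x where "F \<subseteq> E" "unit_nonneg n x"
    "\<And>v. v < n \<Longrightarrow> sum x (nbh F v) = bform n F x x * x v"
    "\<And>F' y. F' \<subseteq> E \<Longrightarrow> unit_nonneg n y \<Longrightarrow>
       (bform n F' y y)\<^sup>2 - c * real (card F') \<le> (bform n F x x)\<^sup>2 - c * real (card F)"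
proof -
  have "\<exists>x. unit_nonneg n x \<and> (\<forall>y. \<bar>bform n F y y\<bar> \<le> bform n F x x * (\<Sum>i<n. (y i)\<^sup>2))" for F
    by (rule rayleigh_max_exists[OF \<open>n > 0\<close>, of F]) blast
  then obtain X where X: "\<And>F. unit_nonneg n (X F)"
    "\<And>F y. \<bar>bform n F y y\<bar> \<le> bform n F (X F) (X F) * (\<Sum>i<n. (y i)\<^sup>2)"
    by metis
  define \<Phi> where "\<Phi> F = (bform n F (X F) (X F))\<^sup>2 - c * real (card F)" for F
  have "finite (Pow E)" using simple_graph_finite[OF G] by simp
  then obtain F where F: "F \<in> Pow E" "Max (\<Phi> ` Pow E) = \<Phi> F"
    using Max_in[of "\<Phi> ` Pow E"] by blast
  have le: "\<Phi> F' \<le> \<Phi> F" if "F' \<subseteq> E" for F'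
    using that \<open>finite (Pow E)\<close> F(2)[symmetric] by (auto intro!: Max_ge)
  show ?thesis
  proof (rule that[of F "X F"])
    show "F \<subseteq> E" using F by simp
    show "unit_nonneg n (X F)" by (rule X(1))
    have "simple_graph n F" using F simple_graph_subset[OF G] by simp
    then show "sum (X F) (nbh F v) = bform n F (X F) (X F) * X F v" if "v < n" for v
      using X(1)[of F] X(2)[of F] that by (intro rayleigh_eigen) (auto intro: order_trans[OF abs_ge_self])
    show "(bform n F' y y)\<^sup>2 - c * real (card F') \<le> (bform n F (X F) (X F))\<^sup>2 - c * real (card F)"
      if "F' \<subseteq> E" "unit_nonneg n y" for F' y
    proof -
      have "\<bar>bform n F' y y\<bar> \<le> \<bar>bform n F' (X F') (X F')\<bar>" using X(2)[where F=F' and y=y] that by simp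
      then have "(bform n F' y y)\<^sup>2 \<le> (bform n F' (X F') (X F'))\<^sup>2" by (simp add: abs_le_square_iff)
      then show ?thesis using le[OF that(1)] by (simp add: \<Phi>_def)
    qed
  qed
qed

section \<open>Edge-critical graphs\<close>

text \<open>\<open>edge\<close> and \<open>deg\<close> record what optimality says about deleting
  one edge and one vertex. The factor \<open>2 - 3a\<close> with \<open>a = (x v)\<^sup>2\<close>
  comes from \<open>(1 - a)\<^sup>2 - (1 - 2a)\<^sup>2 = a (2 - 3a)\<close>.\<close>

locale edge_critical =
  fixes n :: nat and E :: "nat set set" and x :: "nat \<Rightarrow> real" and \<rho> q \<eta> :: real
  assumes G: "simple_graph n E"
    and x0: "\<And>i. 0 \<le> x i" and x1: "(\<Sum>i<n. (x i)\<^sup>2) = 1"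
    and eig: "\<And>v. v < n \<Longrightarrow> sum x (nbh E v) = \<rho> * x v"
    and rho: "1 \<le> \<rho>"
    and q: "1 / 2 \<le> q" "q \<le> 1"
    and eta: "0 < \<eta>" "\<eta> \<le> 1 / 40"
    and edge: "\<And>u v. {u, v} \<in> E \<Longrightarrow> q * (1 - \<eta>) \<le> 2 * \<rho> * (x u * x v)"
    and deg: "\<And>v. v < n \<Longrightarrow> 2 * q * (1 - \<eta>) * real (card (nbh E v)) * (1 - (x v)\<^sup>2)\<^sup>2
                \<le> \<rho>\<^sup>2 * (x v)\<^sup>2 * (2 - 3 * (x v)\<^sup>2)"
begin

definition w :: "nat \<Rightarrow> real" where "w i = (x i)\<^sup>2"

abbreviation N :: "nat \<Rightarrow> nat set" where "N \<equiv> nbh E"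

lemma w_nonneg: "0 \<le> w i"
  by (simp add: w_def)

lemma w_total: "sum w {..<n} = 1"
  using x1 by (simp add: w_def)

lemma w_mono: "A \<subseteq> B \<Longrightarrow> finite B \<Longrightarrow> sum w A \<le> sum w B"
  by (intro sum_mono2) (auto simp: w_nonneg)

lemma w_le_1: "A \<subseteq> {..<n} \<Longrightarrow> sum w A \<le> 1"
  using w_mono[of A "{..<n}"] w_total by simp

lemma w_Int: "A \<subseteq> C \<Longrightarrow> B \<subseteq> C \<Longrightarrow> finite C \<Longrightarrow> sum w A + sum w B \<le> sum w (A \<inter> B) + sum w C"
  using w_mono[of "A \<union> B" C] sum.union_inter[of A B w] finite_subset[of A C] finite_subset[of B C]
  by simp

lemma N_sub: "N v \<subseteq> {..<n}" "finite (N v)"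
  using nbh_subset[OF G] finite_nbh[OF G] by auto

lemma edge_less: "{u, v} \<in> E \<Longrightarrow> u < n \<and> v < n \<and> u \<noteq> v"
  using G by (auto simp: simple_graph_def)

lemma q_eta: "39 / 80 \<le> q * (1 - \<eta>)"
proof -
  have "1 / 2 * (39 / 40) \<le> q * (1 - \<eta>)" using q eta by (intro mult_mono) auto
  then show ?thesis by simp
qed

text \<open>The edge condition squared, using only \<open>q * (1 - \<eta>) \<ge> 1/4\<close>. It
  says that a light vertex has only heavy neighbours.\<close>

lemma edge_w: assumes "{u, v} \<in> E" shows "1 \<le> 64 * \<rho>\<^sup>2 * w u * w v"
proof -
  have "1 \<le> 8 * \<rho> * (x u * x v)" using edge[OF assms] q_eta by simp
  then have "1\<^sup>2 \<le> (8 * \<rho> * (x u * x v))\<^sup>2" by (intro power_mono) auto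
  then show ?thesis by (simp add: w_def power_mult_distrib mult_ac)
qed

lemma edge_w_pos: assumes "{u, v} \<in> E" shows "0 < w v" "w v < 1"
proof -
  have *: "64 * \<rho>\<^sup>2 * w u * w v > 0" using edge_w[OF assms] by linarith
  then have "w u \<noteq> 0" "w v \<noteq> 0" by auto
  then have "w u > 0" "w v > 0" using w_nonneg[of u] w_nonneg[of v] by auto
  moreover have "w u + w v \<le> 1" using w_le_1[of "{u, v}"] edge_less[OF assms] by auto
  ultimately show "0 < w v" "w v < 1" by auto
qed

lemma N_edge: "u \<in> N v \<Longrightarrow> {v, u} \<in> E \<and> {u, v} \<in> E"
  by (simp add: nbh_def insert_commute)

lemma w_lt_1: "N v \<noteq> {} \<Longrightarrow> w v < 1"
  using N_edge edge_w_pos(2) by blast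

text \<open>After division by \<open>(1 - a)\<^sup>2\<close> with \<open>a = w v\<close>, the
  quotient \<open>(2 - 3a) / (2 (1 - a)\<^sup>2)\<close> has maximum \<open>9/8\<close>, at
  \<open>a = 1/3\<close>, and is at most \<open>1 + a\<close>. The first bound is uniform, the
  second is sharp for light vertices.\<close>

lemma degree_upper:
  assumes "v < n"
  shows "q * (1 - \<eta>) * real (card (N v)) \<le> 9 / 8 * (\<rho>\<^sup>2 * w v)" (is ?A)
    and "q * (1 - \<eta>) * real (card (N v)) \<le> \<rho>\<^sup>2 * w v * (1 + w v)" (is ?B)
proof -
  have "?A \<and> ?B"
  proof (cases "N v = {}")
    case False
    let ?d = "q * (1 - \<eta>) * real (card (N v))" and ?p = "(1 - w v)\<^sup>2"
    have p: "?p > 0" using w_lt_1[OF False] by simp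
    have a: "0 \<le> \<rho>\<^sup>2 * w v" using w_nonneg by simp
    have d: "2 * ?d * ?p \<le> \<rho>\<^sup>2 * w v * (2 - 3 * w v)"
      using deg[OF assms] by (simp only: w_def mult.assoc)
    have "2 - 3 * w v \<le> 9 / 4 * ?p"
      using zero_le_power2[of "1 - 3 * w v"] by (simp add: power2_eq_square algebra_simps)
    from mult_left_mono[OF this a] d have "?d * ?p \<le> 9 / 8 * (\<rho>\<^sup>2 * w v) * ?p"
      by (simp add: algebra_simps)
    then have A: ?A using p by simp
    have "2 * (1 + w v) * ?p - (2 - 3 * w v) = w v * ((w v)\<^sup>2 + (1 - w v)\<^sup>2)"
      by (simp add: power2_eq_square algebra_simps)
    moreover have "\<dots> \<ge> 0" using w_nonneg by simp
    ultimately have "2 - 3 * w v \<le> 2 * (1 + w v) * ?p" by simp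
    from mult_left_mono[OF this a] d have "?d * ?p \<le> \<rho>\<^sup>2 * w v * (1 + w v) * ?p"
      by (simp add: algebra_simps)
    then have ?B using p by simp
    with A show ?thesis by blast
  qed (use w_nonneg in simp)
  then show ?A ?B by blast+
qed

text \<open>Cauchy--Schwarz applied to the eigenvalue equation at \<open>v\<close>.\<close>

lemma degree_lower:
  assumes "v < n"
  shows "\<rho>\<^sup>2 * w v \<le> real (card (N v)) * sum w (N v)"
  using sum_squared_le_card[of x "N v"] eig[OF assms] by (simp add: w_def power_mult_distrib)

text \<open>The two opposite degree bounds are compared and \<open>\<rho>\<^sup>2 * w v\<close>
  cancels, leaving \<open>q * (1 - \<eta>) \<le> (1 + w v) * sum w (N v)\<close>; then
  \<open>(1 + w v) * (1 - w v) \<le> 1\<close>.\<close>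

lemma nbh_weight:
  assumes v: "v < n" and pos: "0 < w v"
  shows "q * (1 - \<eta>) * (1 - w v) \<le> sum w (N v)"
proof -
  have s0: "0 \<le> sum w (N v)" by (intro sum_nonneg w_nonneg)
  have "q * (1 - \<eta>) * (\<rho>\<^sup>2 * w v) \<le> q * (1 - \<eta>) * (real (card (N v)) * sum w (N v))"
    using degree_lower[OF v] q_eta by (intro mult_left_mono) auto
  also have "\<dots> = q * (1 - \<eta>) * real (card (N v)) * sum w (N v)" by simp
  also have "\<dots> \<le> \<rho>\<^sup>2 * w v * (1 + w v) * sum w (N v)"
    using degree_upper(2)[OF v] s0 by (intro mult_right_mono)
  finally have "(\<rho>\<^sup>2 * w v) * (q * (1 - \<eta>)) \<le> (\<rho>\<^sup>2 * w v) * ((1 + w v) * sum w (N v))"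
    by (simp add: mult_ac)
  then have le: "q * (1 - \<eta>) \<le> (1 + w v) * sum w (N v)" using pos rho by simp
  have w1: "w v \<le> 1" using w_le_1[of "{v}"] v by simp
  have "q * (1 - \<eta>) * (1 - w v) \<le> (1 + w v) * sum w (N v) * (1 - w v)"
    using le w1 by (intro mult_right_mono) auto
  also have "\<dots> = sum w (N v) - (w v)\<^sup>2 * sum w (N v)" by (simp add: power2_eq_square algebra_simps)
  also have "\<dots> \<le> sum w (N v)" using s0 by simp
  finally show ?thesis .
qed

lemma nbh_weight_small:
  assumes v: "v < n" "0 < w v" "w v \<le> \<eta>"
  shows "q * (1 - 2 * \<eta>) \<le> sum w (N v)"
proof -
  have "1 - 2 * \<eta> \<le> (1 - \<eta>) * (1 - \<eta>)" by (simp add: algebra_simps)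
  also have "\<dots> \<le> (1 - \<eta>) * (1 - w v)" using v eta by (intro mult_left_mono) auto
  finally have "q * (1 - 2 * \<eta>) \<le> q * ((1 - \<eta>) * (1 - w v))" using q by (intro mult_left_mono) auto
  then show ?thesis using nbh_weight[OF v(1,2)] by (simp add: mult.assoc)
qed

text \<open>A heavy vertex has many neighbours, hence a very light one \<open>u\<close>; by the edge condition all
  neighbours of \<open>u\<close> are heavy, so the few heavy vertices \<open>H\<close> carry almost the weight of a
  neighbourhood. A vertex with little weight in \<open>L\<close>, the complement of \<open>H\<close>, among its
  neighbours has too small a degree to be anything but light, and two such vertices cannot be
  adjacent.\<close>

lemma heavy_vertex_case:
  assumes v0: "v0 < n" "M \<le> \<rho> * w v0" and M: "10 ^ 6 \<le> M" "1 \<le> M * \<eta>"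
    and tri: "{a, b} \<in> E" "{b, c} \<in> E" "{a, c} \<in> E"
  shows "2 / 5 < 1 - q * (1 - 2 * \<eta>) \<and>
    (\<exists>i j. {i, j} \<in> E \<and> 16 * \<rho> \<le> M * real (card (N i \<inter> N j)))"
proof -
  have M0: "M > 0" using M(1) by simp
  have d0: "M * \<rho> \<le> real (card (N v0))"
  proof -
    have "M * \<rho> \<le> \<rho> * w v0 * \<rho>" using v0(2) rho by (intro mult_right_mono) auto
    also have "\<dots> = \<rho>\<^sup>2 * w v0" by (simp add: power2_eq_square)
    also have "\<dots> \<le> real (card (N v0)) * sum w (N v0)" by (rule degree_lower[OF v0(1)])
    also have "\<dots> \<le> real (card (N v0)) * 1" using w_le_1 N_sub by (intro mult_left_mono) auto
    finally show ?thesis by simp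
  qed
  have dpos: "real (card (N v0)) > 0" using d0 mult_pos_pos[OF M0, of \<rho>] rho by simp
  \<comment> \<open>Averaging: the neighbourhood has weight at most 1, so some neighbour weighs at
    most the reciprocal of the degree.\<close>
  obtain u where u: "u \<in> N v0" "real (card (N v0)) * w u \<le> 1"
  proof (rule ccontr)
    assume "\<not> thesis"
    then have *: "1 / real (card (N v0)) < w u" if "u \<in> N v0" for u
      using that dpos \<open>\<And>u. \<lbrakk>u \<in> N v0; real (card (N v0)) * w u \<le> 1\<rbrakk> \<Longrightarrow> thesis\<close>
      by (force simp: field_simps)
    have "N v0 \<noteq> {}" using dpos by auto
    then have "(\<Sum>u\<in>N v0. 1 / real (card (N v0))) < sum w (N v0)"
      using N_sub * by (intro sum_strict_mono) auto
    moreover have "(\<Sum>u\<in>N v0. 1 / real (card (N v0))) = 1" using dpos by simp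
    ultimately show False using w_le_1[OF N_sub(1)[of v0]] by simp
  qed
  have un: "u < n" using u N_sub by auto
  have upos: "0 < w u" using u N_edge edge_w_pos by blast
  have uM: "M * \<rho> * w u \<le> 1"
    using u(2) mult_right_mono[OF d0 w_nonneg[of u]] by simp
  have "w u \<le> \<eta>"
  proof -
    have "M * w u * 1 \<le> M * w u * \<rho>" using rho M0 upos by (intro mult_left_mono) auto
    also have "\<dots> = M * \<rho> * w u" by simp
    finally have "M * w u \<le> M * \<eta>" using uM M(2) by linarith
    then show ?thesis using M0 by simp
  qed
  \<comment> \<open>The threshold is what \<open>edge_w\<close> yields for neighbours of a vertex
    \<open>u\<close> with \<open>M * \<rho> * w u \<le> 1\<close>.\<close>
  define H where "H = {y \<in> {..<n}. M \<le> 64 * \<rho> * w y}"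
  define L where "L = {..<n} - H"
  have HL: "H \<subseteq> {..<n}" "finite H" "finite L" "L \<subseteq> {..<n}" by (auto simp: H_def L_def)
  have "N u \<subseteq> H"
  proof
    fix y assume y: "y \<in> N u"
    then have yn: "y < n" using N_sub by auto
    have "M * 1 \<le> M * (64 * \<rho>\<^sup>2 * w u * w y)"
      using edge_w[of u y] N_edge[OF y] M0 by (intro mult_left_mono) auto
    also have "\<dots> = (M * \<rho> * w u) * (64 * \<rho> * w y)" by (simp add: power2_eq_square)
    also have "\<dots> \<le> 1 * (64 * \<rho> * w y)" using uM rho w_nonneg by (intro mult_right_mono) auto
    finally show "y \<in> H" using yn by (simp add: H_def)
  qed
  then have wH: "q * (1 - 2 * \<eta>) \<le> sum w H"
    using nbh_weight_small[OF un upos \<open>w u \<le> \<eta>\<close>] w_mono[of "N u" H] HL by simp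
  have wL: "sum w L \<le> 1 - q * (1 - 2 * \<eta>)"
    using wH sum_diff[OF finite_lessThan HL(1), of w] w_total by (simp add: L_def)
  have cH: "M * real (card H) \<le> 64 * \<rho>"
  proof -
    have "M * real (card H) = (\<Sum>y\<in>H. M)" by simp
    also have "\<dots> \<le> (\<Sum>y\<in>H. 64 * \<rho> * w y)" by (intro sum_mono) (simp add: H_def)
    also have "\<dots> = 64 * \<rho> * sum w H" by (simp add: sum_distrib_left)
    also have "\<dots> \<le> 64 * \<rho> * 1" using w_le_1[OF HL(1)] rho by (intro mult_left_mono) auto
    finally show ?thesis by simp
  qed
  \<comment> \<open>In the eigenvalue equation at \<open>v\<close>, the part over \<open>H\<close>
    is at most \<open>sqrt (card H)\<close>, and the part over \<open>L\<close> at most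
    \<open>29/30\<close> of the total, since
    \<open>30/13 * 2/5 = 12/13 \<le> (29/30)\<^sup>2\<close>. So the total is at most
    \<open>30 * sqrt (card H)\<close>, and \<open>57600 = 900 * 64\<close>.\<close>
  have Q: "M * \<rho> * w v \<le> 57600" if v: "v < n" and le: "sum w (N v \<inter> L) \<le> 2 / 5" for v
  proof -
    let ?y = "\<rho> * x v"
    have y0: "?y \<ge> 0" using rho x0[of v] by simp
    have split: "?y = sum x (N v \<inter> H) + sum x (N v \<inter> L)"
    proof -
      have "N v = (N v \<inter> H) \<union> (N v \<inter> L)" using N_sub(1)[of v] by (auto simp: L_def)
      then have "sum x (N v) = sum x ((N v \<inter> H) \<union> (N v \<inter> L))" by simp
      also have "\<dots> = sum x (N v \<inter> H) + sum x (N v \<inter> L)"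
        using HL by (intro sum.union_disjoint) (auto simp: L_def)
      finally show ?thesis using eig[OF v] by simp
    qed
    have "(sum x (N v \<inter> H))\<^sup>2 \<le> real (card (N v \<inter> H)) * sum w (N v \<inter> H)"
      using sum_squared_le_card[of x "N v \<inter> H"] by (simp add: w_def)
    also have "\<dots> \<le> real (card H) * 1"
      using HL w_le_1[of "N v \<inter> H"] by (intro mult_mono sum_nonneg) (auto intro: card_mono simp: w_nonneg)
    finally have s1: "sum x (N v \<inter> H) \<le> sqrt (real (card H))"
      by (intro real_le_rsqrt) simp
    have "39 / 80 * real (card (N v)) \<le> 9 / 8 * ?y\<^sup>2"
      using mult_right_mono[OF q_eta, of "real (card (N v))"] degree_upper(1)[OF v]
      by (simp add: w_def power_mult_distrib)
    then have dv: "real (card (N v)) \<le> 30 / 13 * ?y\<^sup>2" by simp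
    have "(sum x (N v \<inter> L))\<^sup>2 \<le> real (card (N v \<inter> L)) * sum w (N v \<inter> L)"
      using sum_squared_le_card[of x "N v \<inter> L"] by (simp add: w_def)
    also have "\<dots> \<le> real (card (N v)) * (2 / 5)"
      using N_sub le by (intro mult_mono sum_nonneg) (auto intro: card_mono simp: w_nonneg)
    also have "\<dots> \<le> (29 / 30 * ?y)\<^sup>2"
      using dv zero_le_power2[of ?y] by (simp add: power_mult_distrib power_divide)
    finally have "sum x (N v \<inter> L) \<le> 29 / 30 * ?y"
      by (rule power2_le_imp_le) (use y0 in simp)
    with s1 split have "?y \<le> 30 * sqrt (real (card H))" by simp
    then have "?y\<^sup>2 \<le> (30 * sqrt (real (card H)))\<^sup>2" using y0 by (intro power_mono)
    then have "\<rho> * (\<rho> * w v) \<le> 900 * real (card H)"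
      by (simp add: w_def power_mult_distrib) (simp add: power2_eq_square)
    then have "M * (\<rho> * (\<rho> * w v)) \<le> M * (900 * real (card H))" using M0 by (intro mult_left_mono) auto
    also have "\<dots> \<le> 57600 * \<rho>" using cH by simp
    finally have "\<rho> * (M * \<rho> * w v) \<le> \<rho> * 57600" by (simp add: mult_ac)
    then show ?thesis using rho by (subst (asm) mult_le_cancel_left_pos) auto
  qed
  \<comment> \<open>Two adjacent vertices this light would violate \<open>edge_w\<close>, because
    \<open>8 * 57600 < 10 ^ 6 \<le> M\<close>.\<close>
  have noQ: False if "{i, j} \<in> E" "sum w (N i \<inter> L) \<le> 2 / 5" "sum w (N j \<inter> L) \<le> 2 / 5" for i j
  proof -
    have ij: "i < n" "j < n" using edge_less[OF that(1)] by auto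
    have "M\<^sup>2 * 1 \<le> M\<^sup>2 * (64 * \<rho>\<^sup>2 * w i * w j)" using edge_w[OF that(1)] by (intro mult_left_mono) auto
    also have "\<dots> = 64 * ((M * \<rho> * w i) * (M * \<rho> * w j))" by (simp add: power2_eq_square)
    also have "\<dots> \<le> 64 * (57600 * 57600)"
      using Q[OF ij(1) that(2)] Q[OF ij(2) that(3)] M0 rho w_nonneg by (intro mult_left_mono mult_mono) auto
    finally have "M\<^sup>2 \<le> 64 * (57600 * 57600)" by simp
    moreover have "(10 ^ 6)\<^sup>2 \<le> M\<^sup>2" using M(1) by (intro power_mono) auto
    ultimately show False by simp
  qed
  \<comment> \<open>At most one vertex of the triangle fails to see \<open>2/5\<close> in
    \<open>L\<close>, so two of them do see it.\<close>
  have "\<exists>i j. {i, j} \<in> E \<and> 2 / 5 < sum w (N i \<inter> L) \<and> 2 / 5 < sum w (N j \<inter> L)"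
    using noQ tri by (meson not_less)
  then obtain i j where ij: "{i, j} \<in> E" "2 / 5 < sum w (N i \<inter> L)" "2 / 5 < sum w (N j \<inter> L)" by blast
  have "2 / 5 < 1 - q * (1 - 2 * \<eta>)"
    using ij(2) wL w_mono[of "N i \<inter> L" L] HL by simp
  moreover have "16 * \<rho> \<le> M * real (card (N i \<inter> N j))"
  proof -
    \<comment> \<open>Hence \<open>L\<close> weighs at most \<open>21/40\<close>, and two subsets
      heavier than \<open>2/5\<close> overlap in at least \<open>4/5 - 21/40 > 1/4\<close>. Vertices
      of \<open>L\<close> are light, so this overlap is large in number.\<close>
    have "1 / 2 * (38 / 40) \<le> q * (1 - 2 * \<eta>)" using q eta by (intro mult_mono) auto
    then have "1 / 4 \<le> sum w ((N i \<inter> L) \<inter> (N j \<inter> L))"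
      using w_Int[of "N i \<inter> L" L "N j \<inter> L"] HL ij wL by simp
    then have "64 * \<rho> * (1 / 4) \<le> 64 * \<rho> * sum w ((N i \<inter> L) \<inter> (N j \<inter> L))"
      using rho by (intro mult_left_mono) auto
    also have "\<dots> = (\<Sum>y\<in>(N i \<inter> L) \<inter> (N j \<inter> L). 64 * \<rho> * w y)" by (simp add: sum_distrib_left)
    also have "\<dots> \<le> (\<Sum>y\<in>(N i \<inter> L) \<inter> (N j \<inter> L). M)"
      by (intro sum_mono) (auto simp: L_def H_def)
    also have "\<dots> \<le> M * real (card (N i \<inter> N j))"
      using M0 N_sub by (auto intro!: card_mono)
    finally show ?thesis by simp
  qed
  ultimately show ?thesis using ij(1) by blast
qed

end

section \<open>Counting clique extensions\<close>

lemma finite_cliques: "finite (cliques s n E)"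
  by (rule finite_subset[of _ "Pow {..<n}"]) (auto simp: cliques_def)

text \<open>Double counting of pairs of a clique \<open>S\<close> and an extending vertex
  \<open>u\<close>: an enlarged clique arises from at most \<open>s - 1\<close> of them, one for
  each vertex other than \<open>i\<close> and \<open>j\<close>.\<close>

lemma clique_extension_count:
  assumes i: "i \<noteq> j"
    and ext: "\<And>S. S \<in> cliques s n E \<Longrightarrow> {i, j} \<subseteq> S \<Longrightarrow> t \<le> real (card {u \<in> {..<n}. \<forall>v\<in>S. u \<in> nbh E v})"
    and G: "simple_graph n E"
  shows "t * real (card {S \<in> cliques s n E. {i, j} \<subseteq> S})
    \<le> real (s - 1) * real (card {S \<in> cliques (s + 1) n E. {i, j} \<subseteq> S})"
proof -
  let ?C = "\<lambda>s. {S \<in> cliques s n E. {i, j} \<subseteq> S}"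
  let ?X = "\<lambda>S. {u \<in> {..<n}. \<forall>v\<in>S. u \<in> nbh E v}"
  have fin: "finite (?C s)" for s using finite_cliques by simp
  have fS: "finite S" if "S \<in> ?C k" for S k
    using that finite_subset[of S "{..<n}"] by (auto simp: cliques_def)
  have "t * real (card (?C s)) = (\<Sum>S\<in>?C s. t)" by simp
  also have "\<dots> \<le> (\<Sum>S\<in>?C s. real (card (?X S)))" using ext by (intro sum_mono) auto
  also have "\<dots> = real (card (SIGMA S:?C s. ?X S))" using fin by (simp add: card_SigmaI)
  also have "\<dots> \<le> real (card (SIGMA T:?C (s + 1). T - {i, j}))"
  proof -
    have "inj_on (\<lambda>(S, u). (insert u S, u)) (SIGMA S:?C s. ?X S)"
    proof (rule inj_onI)
      fix p p' assume p: "p \<in> (SIGMA S:?C s. ?X S)" "p' \<in> (SIGMA S:?C s. ?X S)"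
        and eq: "(\<lambda>(S, u). (insert u S, u)) p = (\<lambda>(S, u). (insert u S, u)) p'"
      obtain S u S' u' where pp: "p = (S, u)" "p' = (S', u')" by fastforce
      with p have "u \<notin> S" "u' \<notin> S'" using nbh_irrefl[OF G] by auto
      then show "p = p'" using eq pp by (auto simp: insert_ident)
    qed
    moreover have "(\<lambda>(S, u). (insert u S, u)) ` (SIGMA S:?C s. ?X S) \<subseteq> (SIGMA T:?C (s + 1). T - {i, j})"
    proof clarify
      fix S u assume S: "S \<in> cliques s n E" "{i, j} \<subseteq> S" and u: "u < n" "\<forall>v\<in>S. u \<in> nbh E v"
      have "u \<notin> S" using u nbh_irrefl[OF G] by blast
      moreover have "finite S" using fS[of S s] S by blast
      moreover have "{u, v} \<in> E \<and> {v, u} \<in> E" if "v \<in> S" for v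
        using u that by (auto simp: nbh_def insert_commute)
      ultimately have "insert u S \<in> cliques (s + 1) n E"
        using S u by (auto simp: cliques_def)
      with S \<open>u \<notin> S\<close> show "insert u S \<in> ?C (s + 1) \<and> u \<in> insert u S - {i, j}" by auto
    qed
    moreover have "finite (SIGMA T:?C (s + 1). T - {i, j})"
      using fin fS by (intro finite_SigmaI) auto
    ultimately show ?thesis by (intro of_nat_mono card_inj_on_le)
  qed
  also have "card (SIGMA T:?C (s + 1). T - {i, j}) = (\<Sum>T\<in>?C (s + 1). card (T - {i, j}))"
    using fin fS by (intro card_SigmaI) auto
  also have "\<dots> = (\<Sum>T\<in>?C (s + 1). s - 1)"
    using i by (intro sum.cong refl) (auto simp: cliques_def card_Diff_subset)
  finally show ?thesis by (simp add: mult.commute)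
qed

lemma clique_count_from_extensions:
  assumes ij: "{i, j} \<in> E" and G: "simple_graph n E" and t: "0 \<le> t" and "1 \<le> r"
    and ext: "\<And>s S. 2 \<le> s \<Longrightarrow> s \<le> r \<Longrightarrow> S \<in> cliques s n E \<Longrightarrow> {i, j} \<subseteq> S \<Longrightarrow>
        t \<le> real (card {u \<in> {..<n}. \<forall>v\<in>S. u \<in> nbh E v})"
  shows "(t / real r) ^ (r - 1) \<le> real (card {S \<in> cliques (r + 1) n E. {i, j} \<subseteq> S})"
proof -
  have "i \<noteq> j" "i < n" "j < n" using ij G by (auto simp: simple_graph_def)
  \<comment> \<open>\<open>k\<close> counts the vertices added to \<open>{i, j}\<close>; each
    addition multiplies the number of cliques by at least \<open>t / r\<close>.\<close>
  have "(t / real r) ^ k \<le> real (card {S \<in> cliques (k + 2) n E. {i, j} \<subseteq> S})" if "k \<le> r - 1" for k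
    using that
  proof (induction k)
    case 0
    have "{i, j} \<in> cliques 2 n E"
      using ij \<open>i \<noteq> j\<close> \<open>i < n\<close> \<open>j < n\<close> by (auto simp: cliques_def insert_commute)
    then have "{S \<in> cliques 2 n E. {i, j} \<subseteq> S} \<noteq> {}" by blast
    then have "card {S \<in> cliques 2 n E. {i, j} \<subseteq> S} > 0" using finite_cliques by (simp add: card_gt_0_iff)
    then have "1 \<le> card {S \<in> cliques 2 n E. {i, j} \<subseteq> S}" by linarith
    then show ?case by (simp add: numeral_2_eq_2)
  next
    case (Suc k)
    let ?C = "\<lambda>s. real (card {S \<in> cliques s n E. {i, j} \<subseteq> S})"
    have "t * (t / real r) ^ k \<le> t * ?C (k + 2)" using Suc t by (intro mult_left_mono) auto
    also have "\<dots> \<le> real (k + 2 - 1) * ?C (k + 2 + 1)"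
      using Suc.prems by (intro clique_extension_count[OF \<open>i \<noteq> j\<close>] ext G) auto
    also have "\<dots> \<le> real r * ?C (k + 2 + 1)" using Suc.prems by (intro mult_right_mono) auto
    finally show ?case using \<open>1 \<le> r\<close> by (simp add: field_simps)
  qed
  from this[of "r - 1"] show ?thesis using \<open>1 \<le> r\<close> by simp
qed

section \<open>Common neighbourhoods in edge-critical graphs\<close>

context edge_critical
begin

text \<open>A union bound: each \<open>v\<close> in \<open>T\<close> costs at most the weight
  outside its neighbourhood.\<close>

lemma w_common_nbh:
  assumes "A \<subseteq> {..<n}" "finite T"
  shows "sum w A - (\<Sum>v\<in>T. 1 - sum w (N v)) \<le> sum w (A \<inter> {u. \<forall>v\<in>T. u \<in> N v})"
  using assms(2)
proof (induction T rule: finite_induct)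
  case (insert v T)
  let ?B = "A \<inter> {u. \<forall>v\<in>T. u \<in> N v}"
  have "sum w ?B + sum w (N v) \<le> sum w (?B \<inter> N v) + 1"
    using w_Int[of ?B "{..<n}" "N v"] assms(1) N_sub w_total by auto
  moreover have "?B \<inter> N v = A \<inter> {u. \<forall>v\<in>insert v T. u \<in> N v}" by auto
  ultimately show ?case using insert by simp
qed simp

text \<open>Any two neighbourhoods meet in weight at least \<open>1 - 2/r - 2\<delta>\<close>.
  Averaging over all pairs of the clique adds the term \<open>2 / (r\<^sup>2 (r + 1))\<close>,
  because the number of neighbours in \<open>K\<close> is an integer while its mean may be as low as
  \<open>r - 1/r\<close> up to \<open>\<delta>\<close>.\<close>

lemma large_codegree:
  assumes q_def: "q = 1 - 1 / real r" and r: "2 \<le> r" and K: "finite K" "card K = r + 1"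
    and \<delta>: "0 \<le> \<delta>" and d: "\<And>v. v \<in> K \<Longrightarrow> q - \<delta> \<le> sum w (N v)"
  obtains i j where "i \<in> K" "j \<in> K" "i \<noteq> j"
    "1 - 2 / real r + 2 / (real r ^ 2 * (real r + 1)) - 2 * \<delta> \<le> sum w (N i \<inter> N j)"
proof (rule ccontr)
  assume no: "\<not> thesis"
  note cod = that
  define \<kappa> where "\<kappa> = 1 - 2 / real r + 2 / (real r ^ 2 * (real r + 1)) - 2 * \<delta>"
  have lt: "sum w (N i \<inter> N j) < \<kappa>" if "i \<in> K" "j \<in> K - {i}" for i j
  proof (rule ccontr)
    assume "\<not> ?thesis"
    then have thesis using cod[of i j] that by (auto simp: \<kappa>_def)
    with no show False ..
  qed
  define \<alpha> where "\<alpha> u = (\<Sum>i\<in>K. of_bool (u \<in> N i) :: real)" for u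
  have ws: "sum w (N i \<inter> B) = (\<Sum>u<n. w u * of_bool (u \<in> N i \<inter> B))" for i B
  proof -
    have "sum w (N i \<inter> B) = (\<Sum>u\<in>N i \<inter> B. w u * of_bool (u \<in> N i \<inter> B))" by (intro sum.cong) auto
    also have "\<dots> = (\<Sum>u<n. w u * of_bool (u \<in> N i \<inter> B))"
      using N_sub by (intro sum.mono_neutral_left) auto
    finally show ?thesis .
  qed
  \<comment> \<open>\<open>S1\<close> and \<open>S2\<close> express the first two factorial moments
    of \<open>\<alpha>\<close> under \<open>w\<close> by neighbourhoods and codegrees.\<close>
  have S1: "(\<Sum>i\<in>K. sum w (N i)) = (\<Sum>u<n. w u * \<alpha> u)"
    using ws[of _ UNIV] by (simp add: \<alpha>_def sum_distrib_left sum.swap[of _ K])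
  have "(\<Sum>i\<in>K. \<Sum>j\<in>K - {i}. sum w (N i \<inter> N j))
      = (\<Sum>i\<in>K. \<Sum>j\<in>K - {i}. \<Sum>u<n. w u * (of_bool (u \<in> N i) * of_bool (u \<in> N j)))"
    unfolding ws by (intro sum.cong refl) auto
  also have "\<dots> = (\<Sum>i\<in>K. \<Sum>u<n. \<Sum>j\<in>K - {i}. w u * (of_bool (u \<in> N i) * of_bool (u \<in> N j)))"
    by (intro sum.cong refl sum.swap)
  also have "\<dots> = (\<Sum>u<n. \<Sum>i\<in>K. \<Sum>j\<in>K - {i}. w u * (of_bool (u \<in> N i) * of_bool (u \<in> N j)))"
    by (rule sum.swap)
  also have "\<dots> = (\<Sum>u<n. w u * (\<alpha> u * (\<alpha> u - 1)))"
  proof (intro sum.cong refl)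
    fix u
    have "(\<Sum>j\<in>K - {i}. w u * (of_bool (u \<in> N i) * of_bool (u \<in> N j)))
        = w u * (of_bool (u \<in> N i) * (\<alpha> u - 1))" if "i \<in> K" for i
    proof -
      have "(\<Sum>j\<in>K - {i}. w u * (of_bool (u \<in> N i) * of_bool (u \<in> N j)))
        = w u * (of_bool (u \<in> N i) * (\<Sum>j\<in>K - {i}. of_bool (u \<in> N j)))"
        by (simp add: sum_distrib_left)
      also have "(\<Sum>j\<in>K - {i}. of_bool (u \<in> N j)) = \<alpha> u - of_bool (u \<in> N i)"
        unfolding \<alpha>_def by (simp only: sum.remove[OF K(1) that])
      finally show ?thesis by auto
    qed
    then have "(\<Sum>i\<in>K. \<Sum>j\<in>K - {i}. w u * (of_bool (u \<in> N i) * of_bool (u \<in> N j)))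
        = (\<Sum>i\<in>K. w u * (of_bool (u \<in> N i) * (\<alpha> u - 1)))" by (intro sum.cong) auto
    also have "\<dots> = w u * ((\<Sum>i\<in>K. of_bool (u \<in> N i)) * (\<alpha> u - 1))"
      by (simp add: sum_distrib_left sum_distrib_right)
    finally show "(\<Sum>i\<in>K. \<Sum>j\<in>K - {i}. w u * (of_bool (u \<in> N i) * of_bool (u \<in> N j)))
        = w u * (\<alpha> u * (\<alpha> u - 1))" by (simp add: \<alpha>_def)
  qed
  finally have S2: "(\<Sum>i\<in>K. \<Sum>j\<in>K - {i}. sum w (N i \<inter> N j)) = (\<Sum>u<n. w u * (\<alpha> u * (\<alpha> u - 1)))" .
  \<comment> \<open>As \<open>\<alpha> u\<close> is an integer, \<open>(\<alpha> u - (r - 1)) (\<alpha> u - r) \<ge> 0\<close>.\<close>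
  have conv: "(real r - 1) * (2 * \<alpha> u - real r) \<le> \<alpha> u * (\<alpha> u - 1)" for u
  proof -
    obtain k :: int where k: "\<alpha> u = of_int k"
    proof
      show "\<alpha> u = of_int (\<Sum>i\<in>K. of_bool (u \<in> N i))" by (simp add: \<alpha>_def)
    qed
    have "0 \<le> (k - (int r - 1)) * (k - int r)"
      by (cases "k \<le> int r - 1") (auto intro: mult_nonneg_nonneg mult_nonpos_nonpos)
    then have "0 \<le> (of_int ((k - (int r - 1)) * (k - int r)) :: real)" by (simp only: of_int_0_le_iff)
    then show ?thesis by (simp add: k algebra_simps)
  qed
  have "(real r - 1) * (2 * ((real r + 1) * (q - \<delta>)) - real r)
      \<le> (real r - 1) * (2 * (\<Sum>i\<in>K. sum w (N i)) - real r)"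
  proof -
    have "(real r + 1) * (q - \<delta>) = (\<Sum>i\<in>K. q - \<delta>)" using K by simp
    also have "\<dots> \<le> (\<Sum>i\<in>K. sum w (N i))" using d by (intro sum_mono) auto
    finally show ?thesis using r by (intro mult_left_mono) auto
  qed
  also have "\<dots> = (real r - 1) * (2 * (\<Sum>u<n. w u * \<alpha> u) - (\<Sum>u<n. w u) * real r)"
    using S1 w_total by simp
  also have "\<dots> = (\<Sum>u<n. w u * ((real r - 1) * (2 * \<alpha> u - real r)))"
    by (simp add: sum_distrib_left sum_distrib_right sum_subtractf[symmetric] algebra_simps)
  also have "\<dots> \<le> (\<Sum>u<n. w u * (\<alpha> u * (\<alpha> u - 1)))"
    using conv w_nonneg by (intro sum_mono mult_left_mono) auto
  also have "\<dots> < (\<Sum>i\<in>K. \<Sum>j\<in>K - {i}. \<kappa>)"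
    unfolding S2[symmetric]
  proof (intro sum_strict_mono)
    show "K \<noteq> {}" using K by auto
    show "K - {i} \<noteq> {}" if "i \<in> K" for i
      using that K r by (metis card_Diff_singleton card.empty add_diff_cancel_right' not_numeral_le_zero)
  qed (use K lt in auto)
  also have "\<dots> = (real r + 1) * real r * \<kappa>" using K by (simp add: card_Diff_singleton_if)
  also have "\<dots> = (real r - 1) * (2 * ((real r + 1) * q) - real r) - 2 * (real r + 1) * real r * \<delta>"
  proof -
    have "(real r + 1) * real r * (2 / (real r ^ 2 * (real r + 1))) = 2 / real r"
      by (simp add: divide_simps power2_eq_square)
    moreover have "(real r + 1) * real r * (1 - 2 / real r - 2 * \<delta>) + 2 / real r
        = (real r - 1) * (2 * ((real r + 1) * q) - real r) - 2 * (real r + 1) * real r * \<delta>"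
      unfolding q_def using r by (simp add: field_simps)
    ultimately show ?thesis unfolding \<kappa>_def by (simp only: distrib_left right_diff_distrib)
  qed
  also have "\<dots> \<le> (real r - 1) * (2 * ((real r + 1) * (q - \<delta>)) - real r)"
    using \<delta> by (simp add: algebra_simps)
  finally show False by simp
qed

text \<open>All weights are at most \<open>M / \<rho>\<close>, so a common neighbourhood of weight
  \<open>\<beta>\<close> has at least \<open>\<beta> * \<rho> / M\<close> vertices and the greedy
  count applies.\<close>

lemma light_vertices_case:
  assumes q_def: "q = 1 - 1 / real r" and r: "2 \<le> r" and K: "K \<in> cliques (r + 1) n E"
    and light: "\<And>v. v < n \<Longrightarrow> \<rho> * w v \<le> M" and M: "0 < M" "M \<le> \<eta> * \<rho>"
    and eta_def: "2 * \<eta> = 1 / (real r ^ 2 * (real r + 1) * (real r + 2))"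
    and beta_def: "\<beta> = 1 / (real r ^ 2 * (real r + 1))"
  obtains e where "e \<in> E"
    "(\<beta> * \<rho> / (M * real r)) ^ (r - 1) \<le> real (card {S \<in> cliques (r + 1) n E. e \<subseteq> S})"
proof -
  define \<delta> where "\<delta> = 2 * \<eta>"
  have \<delta>0: "\<delta> \<ge> 0" using eta by (simp add: \<delta>_def)
  have nb: "q - \<delta> \<le> sum w (N v)" if "{u, v} \<in> E" for u v
  proof -
    have v: "v < n" using edge_less[OF that] by simp
    have "\<rho> * w v \<le> \<rho> * \<eta>" using light[OF v] M by (simp add: mult.commute)
    then have "w v \<le> \<eta>" using rho by simp
    from nbh_weight_small[OF v edge_w_pos(1)[OF that] this] have "q - q * \<delta> \<le> sum w (N v)"
      by (simp add: \<delta>_def algebra_simps)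
    moreover have "q * \<delta> \<le> 1 * \<delta>" using q \<delta>0 by (intro mult_right_mono) auto
    ultimately show ?thesis by simp
  qed
  have Kf: "finite K" "card K = r + 1" and Ke: "\<And>u v. u \<in> K \<Longrightarrow> v \<in> K \<Longrightarrow> u \<noteq> v \<Longrightarrow> {u, v} \<in> E"
    using K finite_subset[of K "{..<n}"] by (auto simp: cliques_def)
  have Kd: "q - \<delta> \<le> sum w (N v)" if "v \<in> K" for v
  proof -
    have "K - {v} \<noteq> {}" using that Kf r by (metis card_Diff_singleton card.empty add_diff_cancel_right' not_numeral_le_zero)
    then obtain u where "u \<in> K" "u \<noteq> v" by blast
    then show ?thesis using nb Ke that by blast
  qed
  obtain i j where ij: "i \<in> K" "j \<in> K" "i \<noteq> j"
    "1 - 2 / real r + 2 / (real r ^ 2 * (real r + 1)) - 2 * \<delta> \<le> sum w (N i \<inter> N j)"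
    using large_codegree[OF q_def r Kf \<delta>0 Kd] by blast
  then have e: "{i, j} \<in> E" using Ke by blast
  \<comment> \<open>The error budget: the surplus \<open>2\<beta>\<close> pays
    \<open>2\<delta>\<close> for the pair and \<open>(r - 2)\<delta>\<close> for the other vertices,
    and \<open>2\<beta> - r\<delta> \<ge> \<beta>\<close> remains.\<close>
  have bd: "\<beta> = (real r + 2) * \<delta>"
    unfolding beta_def \<delta>_def eta_def by (simp add: add_nonneg_eq_0_iff)
  have "(\<beta> * \<rho> / M / real r) ^ (r - 1) \<le> real (card {S \<in> cliques (r + 1) n E. {i, j} \<subseteq> S})"
  proof (rule clique_count_from_extensions[OF e G])
    have "\<beta> \<ge> 0" using r by (simp add: beta_def)
    then show "0 \<le> \<beta> * \<rho> / M" using M rho by simp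
    show "1 \<le> r" using r by simp
    fix s S assume s: "2 \<le> s" "s \<le> r" and S: "S \<in> cliques s n E" "{i, j} \<subseteq> S"
    let ?X = "{u \<in> {..<n}. \<forall>v\<in>S. u \<in> N v}"
    have fS: "finite S" "card S = s" using S finite_subset[of S "{..<n}"] by (auto simp: cliques_def)
    have Xeq: "?X = (N i \<inter> N j) \<inter> {u. \<forall>v\<in>S - {i, j}. u \<in> N v}"
      using S N_sub(1)[of i] by auto
    have "(\<Sum>v\<in>S - {i, j}. 1 - sum w (N v)) \<le> (\<Sum>v\<in>S - {i, j}. 1 / real r + \<delta>)"
    proof (rule sum_mono)
      fix v assume "v \<in> S - {i, j}"
      then have "{i, v} \<in> E" using S by (auto simp: cliques_def)
      then show "1 - sum w (N v) \<le> 1 / real r + \<delta>" using nb q_def by fastforce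
    qed
    also have "\<dots> = (real s - 2) * (1 / real r + \<delta>)"
      using fS S ij s by (simp add: card_Diff_subset of_nat_diff)
    \<comment> \<open>At most \<open>r - 2\<close> further vertices, each missing about
      \<open>1/r\<close>, use up just the \<open>1 - 2/r\<close> guaranteed for the pair.\<close>
    also have "\<dots> \<le> (real r - 2) * (1 / real r + \<delta>)"
      using s \<delta>0 by (intro mult_right_mono) auto
    also have "\<dots> = 1 - 2 / real r + (real r - 2) * \<delta>" using r by (simp add: field_simps)
    finally have "(\<Sum>v\<in>S - {i, j}. 1 - sum w (N v)) \<le> 1 - 2 / real r + (real r - 2) * \<delta>" .
    moreover have "sum w (N i \<inter> N j) - (\<Sum>v\<in>S - {i, j}. 1 - sum w (N v)) \<le> sum w ?X"
      unfolding Xeq using N_sub fS by (intro w_common_nbh) auto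
    ultimately have "2 / (real r ^ 2 * (real r + 1)) - real r * \<delta> \<le> sum w ?X"
      using ij(4) by (simp add: algebra_simps)
    moreover have "2 / (real r ^ 2 * (real r + 1)) = 2 * \<beta>" by (simp add: beta_def)
    ultimately have "\<beta> \<le> sum w ?X" using bd \<delta>0 by (simp add: algebra_simps)
    then have "\<rho> * \<beta> \<le> \<rho> * sum w ?X" using rho by simp
    also have "\<dots> = (\<Sum>u\<in>?X. \<rho> * w u)" by (simp add: sum_distrib_left)
    also have "\<dots> \<le> (\<Sum>u\<in>?X. M)" using light by (intro sum_mono) auto
    finally have "\<rho> * \<beta> \<le> real (card ?X) * M" by simp
    then show "\<beta> * \<rho> / M \<le> real (card ?X)" using M by (simp add: field_simps)
  qed
  with e show ?thesis by (intro that[of "{i, j}"]) (simp_all only: divide_divide_eq_left)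
qed

end

section \<open>Passing to an edge-critical subgraph\<close>

lemma js_ge:
  assumes "simple_graph n E" "e \<in> E"
  shows "card {S \<in> cliques s n E. e \<subseteq> S} \<le> js s n E"
  using assms simple_graph_finite[OF assms(1)] by (auto simp: js_def intro!: Max_ge)

lemma cliques_mono: "F \<subseteq> E \<Longrightarrow> cliques s n F \<subseteq> cliques s n E"
  by (auto simp: cliques_def)

lemma js_mono:
  assumes G: "simple_graph n E" and "F \<subseteq> E" "e \<in> F"
  shows "card {S \<in> cliques s n F. e \<subseteq> S} \<le> js s n E"
proof -
  have "card {S \<in> cliques s n F. e \<subseteq> S} \<le> card {S \<in> cliques s n E. e \<subseteq> S}"
    using cliques_mono[OF assms(2)] finite_cliques by (intro card_mono) auto
  then show ?thesis using js_ge[OF G] assms by (meson order_trans subsetD)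
qed

lemma edge_critical_subgraph:
  assumes G: "simple_graph n E" and "n > 0"
    and q: "1 / 2 \<le> q" "q \<le> 1" and eta: "0 < \<eta>" "\<eta> \<le> 1 / 40"
    and y: "unit_nonneg n y" and large: "(bform n E y y)\<^sup>2 > q * (2 * real (card E))"
  obtains F x where "F \<subseteq> E" "unit_nonneg n x" "edge_critical n F x (bform n F x x) q \<eta>"
    "(bform n F x x)\<^sup>2 > q * (2 * real (card F))"
    "(bform n F x x)\<^sup>2 \<ge> \<eta> * real (card E)"
proof -
  \<comment> \<open>The price is slightly below \<open>2q\<close>, so comparison with the whole
    graph leaves the surplus \<open>2 * q * \<eta> * card E\<close>, which bounds
    \<open>\<rho>\<close> below in terms of the original edge count.\<close>
  define c where "c = 2 * q * (1 - \<eta>)"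
  obtain F x where F: "F \<subseteq> E" "unit_nonneg n x"
    and eig: "\<And>v. v < n \<Longrightarrow> sum x (nbh F v) = bform n F x x * x v"
    and max: "\<And>F' y. F' \<subseteq> E \<Longrightarrow> unit_nonneg n y \<Longrightarrow>
       (bform n F' y y)\<^sup>2 - c * real (card F') \<le> (bform n F x x)\<^sup>2 - c * real (card F)"
    using charged_maximizer_exists[OF G \<open>n > 0\<close>, of c] by metis
  define \<rho> where "\<rho> = bform n F x x"
  have GF: "simple_graph n F" using simple_graph_subset[OF G F(1)] .
  have finF: "finite F" using simple_graph_finite[OF GF] .
  have x0: "\<And>i. 0 \<le> x i" using F(2) by simp
  have \<rho>0: "\<rho> \<ge> 0" unfolding \<rho>_def using x0 by (intro bform_nonneg)
  have mE: "real (card F) \<le> real (card E)"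
    using card_mono[OF simple_graph_finite[OF G] F(1)] by simp
  have gain: "c * real (card F) + 2 * q * \<eta> * real (card E) < \<rho>\<^sup>2"
    using max[OF order_refl y] large unfolding c_def \<rho>_def by (simp add: algebra_simps)
  have big: "q * (2 * real (card F)) < \<rho>\<^sup>2"
  proof -
    have "2 * q * \<eta> * real (card F) \<le> 2 * q * \<eta> * real (card E)"
      using mE q eta by (intro mult_left_mono) auto
    then show ?thesis using gain by (simp add: c_def algebra_simps)
  qed
  have cge: "c \<ge> 0" using q eta by (simp add: c_def)
  have lower: "\<eta> * real (card E) \<le> \<rho>\<^sup>2"
  proof -
    have "1 * (\<eta> * real (card E)) \<le> 2 * q * (\<eta> * real (card E))"
      using q eta by (intro mult_right_mono) auto
    moreover have "c * real (card F) \<ge> 0" using cge by simp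
    ultimately show ?thesis using gain by simp
  qed
  have "F \<noteq> {}"
  proof
    assume "F = {}"
    then have "\<rho> = 0" by (simp add: \<rho>_def bform_def)
    then show False using big q by (simp add: mult_less_0_iff)
  qed
  then have "real (card F) \<ge> 1" using finF by (simp add: Suc_le_eq card_gt_0_iff)
  then have "1 \<le> q * (2 * real (card F))" using q mult_mono[of "1/2" q 2 "2 * real (card F)"] by simp
  then have "1\<^sup>2 \<le> \<rho>\<^sup>2" using big by simp
  then have \<rho>1: "1 \<le> \<rho>" using \<rho>0 by (rule power2_le_imp_le)
  have edge: "q * (1 - \<eta>) \<le> 2 * \<rho> * (x u * x v)" if uv: "{u, v} \<in> F" for u v
  proof -
    have "(bform n (F - {{u, v}}) x x)\<^sup>2 - c * real (card (F - {{u, v}})) \<le> \<rho>\<^sup>2 - c * real (card F)"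
      unfolding \<rho>_def using F by (intro max) auto
    moreover have "real (card (F - {{u, v}})) = real (card F) - 1"
      using uv finF \<open>F \<noteq> {}\<close> by (simp add: card_Diff_singleton of_nat_diff Suc_le_eq card_gt_0_iff)
    ultimately have le: "(bform n (F - {{u, v}}) x x)\<^sup>2 + c \<le> \<rho>\<^sup>2" by (simp add: algebra_simps)
    let ?b = "bform n (F - {{u, v}}) x x" and ?p = "x u * x v"
    have b: "\<rho> - 2 * ?p \<le> ?b" using bform_remove_edge[OF GF uv x0] by (simp add: \<rho>_def)
    have b0: "0 \<le> ?b" using x0 by (intro bform_nonneg)
    \<comment> \<open>If \<open>2 * ?p\<close> exceeds \<open>\<rho>\<close>, squaring the lower
      bound for \<open>?b\<close> is not allowed; then \<open>c \<le> \<rho>\<^sup>2\<close> already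
      suffices.\<close>
    have "c \<le> 4 * \<rho> * ?p"
    proof (cases "\<rho> - 2 * ?p \<ge> 0")
      case True
      then have "(\<rho> - 2 * ?p)\<^sup>2 \<le> ?b\<^sup>2" using b by (intro power_mono) auto
      then have "c \<le> \<rho>\<^sup>2 - (\<rho> - 2 * ?p)\<^sup>2" using le by simp
      also have "\<dots> = 4 * \<rho> * ?p - 4 * ?p\<^sup>2" by (simp add: power2_eq_square algebra_simps)
      finally show ?thesis using zero_le_power2[of ?p] by linarith
    next
      case False
      then have "\<rho> * \<rho> \<le> \<rho> * (2 * ?p)" using \<rho>0 by (intro mult_left_mono) auto
      moreover have "c \<le> \<rho>\<^sup>2" using le zero_le_power2[of ?b] by linarith
      moreover have "0 \<le> \<rho> * ?p" using \<rho>0 x0 by simp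
      ultimately show ?thesis by (simp add: power2_eq_square)
    qed
    then show ?thesis by (simp add: c_def)
  qed
  have deg: "2 * q * (1 - \<eta>) * real (card (nbh F v)) * (1 - (x v)\<^sup>2)\<^sup>2
      \<le> \<rho>\<^sup>2 * (x v)\<^sup>2 * (2 - 3 * (x v)\<^sup>2)" if v: "v < n" for v
  proof -
    define a where "a = (x v)\<^sup>2"
    define F' where "F' = {e \<in> F. v \<notin> e}"
    define z where "z = x(v := 0)"
    have zsum: "(\<Sum>i<n. (z i)\<^sup>2) = 1 - a"
    proof -
      have "(\<Sum>i<n. (z i)\<^sup>2) = (\<Sum>i\<in>{..<n} - {v}. (x i)\<^sup>2)"
        using v by (subst sum.remove[of "{..<n}" v]) (auto simp: z_def intro!: sum.cong)
      then show ?thesis using F(2) v by (simp add: sum_diff1 a_def)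
    qed
    have a1: "a \<le> 1"
      using zsum sum_nonneg[of "{..<n}" "\<lambda>i. (z i)\<^sup>2"] by simp
    have zb: "bform n F' z z = \<rho> * (1 - 2 * a)"
      unfolding F'_def z_def bform_remove_vertex[OF GF v eig[OF v]]
      by (simp add: \<rho>_def a_def algebra_simps)
    have cF': "real (card F') = real (card F) - real (card (nbh F v))"
    proof -
      have "F = F' \<union> {e \<in> F. v \<in> e}" "F' \<inter> {e \<in> F. v \<in> e} = {}" by (auto simp: F'_def)
      then have "card F = card F' + card {e \<in> F. v \<in> e}"
        using finF by (metis card_Un_disjoint finite_Un)
      then show ?thesis using card_edges_at[OF GF, of v] by simp
    qed
    show ?thesis
    proof (cases "a = 1")
      case True
      \<comment> \<open>If \<open>x\<close> were concentrated on \<open>v\<close>, the remaining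
        form would be \<open>- \<rho> < 0\<close>.\<close>
      have "bform n F' z z \<ge> 0" using x0 by (intro bform_nonneg) (auto simp: z_def)
      then have "\<rho> \<le> 0" using zb True by simp
      then show ?thesis using \<rho>1 by simp
    next
      case False
      with a1 have a: "1 - a > 0" by simp
      \<comment> \<open>Renormalizes the vector left after zeroing \<open>v\<close>, whose squared
        norm is \<open>1 - a\<close>.\<close>
      define k where "k = 1 / sqrt (1 - a)"
      have k2: "k\<^sup>2 = 1 / (1 - a)" using a by (simp add: k_def power_divide)
      have "unit_nonneg n (\<lambda>i. k * z i)"
      proof
        show "\<forall>i. 0 \<le> k * z i" using x0 a by (simp add: k_def z_def)
        show "(\<Sum>i<n. (k * z i)\<^sup>2) = 1"
          unfolding power_mult_distrib sum_distrib_left[symmetric] zsum k2 using a by simp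
      qed
      then have "(bform n F' (\<lambda>i. k * z i) (\<lambda>i. k * z i))\<^sup>2 - c * real (card F') \<le> \<rho>\<^sup>2 - c * real (card F)"
        unfolding \<rho>_def using F by (intro max) (auto simp: F'_def)
      then have le: "(\<rho> * (1 - 2 * a) / (1 - a))\<^sup>2 + c * real (card (nbh F v)) \<le> \<rho>\<^sup>2"
        unfolding bform_scale zb k2 cF' right_diff_distrib[of c] by simp
      have "((\<rho> * (1 - 2 * a) / (1 - a))\<^sup>2 + c * real (card (nbh F v))) * (1 - a)\<^sup>2 \<le> \<rho>\<^sup>2 * (1 - a)\<^sup>2"
        using le by (intro mult_right_mono) auto
      moreover have "(\<rho> * (1 - 2 * a) / (1 - a))\<^sup>2 * (1 - a)\<^sup>2 = \<rho>\<^sup>2 * (1 - 2 * a)\<^sup>2"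
        using a by (simp add: power_divide power_mult_distrib)
      ultimately have "c * real (card (nbh F v)) * (1 - a)\<^sup>2 \<le> \<rho>\<^sup>2 * (1 - a)\<^sup>2 - \<rho>\<^sup>2 * (1 - 2 * a)\<^sup>2"
        by (simp add: distrib_right)
      also have "\<dots> = \<rho>\<^sup>2 * a * (2 - 3 * a)" by (simp add: power2_eq_square algebra_simps)
      finally show ?thesis by (simp add: c_def a_def)
    qed
  qed
  have "edge_critical n F x \<rho> q \<eta>"
    by unfold_locales (use GF F(2) x0 eig \<rho>1 q eta edge deg in \<open>auto simp: \<rho>_def\<close>)
  then show ?thesis using that[OF F] big lower by (simp add: \<rho>_def)
qed

section \<open>The joint bound\<close>

text \<open>Turns the real exponent into a natural one. For \<open>m = 0\<close> both sides are 0,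
  as \<open>r - 1 > 0\<close>.\<close>

lemma powr_half_power:
  assumes "2 \<le> r"
  shows "real m powr ((real r - 1) / 2) = sqrt (real m) ^ (r - 1)"
proof (cases "m = 0")
  case False
  have "sqrt (real m) ^ (r - 1) = sqrt (real m) powr real (r - 1)"
    using False by (subst powr_realpow) auto
  also have "\<dots> = (real m powr (1 / 2)) powr (real r - 1)"
    using assms by (simp add: powr_half_sqrt of_nat_diff)
  also have "\<dots> = real m powr ((real r - 1) / 2)" by (simp add: powr_powr)
  finally show ?thesis by simp
qed (use assms in simp)

lemma js_lower_bound_critical:
  assumes r: "2 \<le> r" and C: "edge_critical n F x \<rho> (1 - 1 / real r) \<eta>"
    and K: "K \<in> cliques (r + 1) n F"
    and eta_eq: "2 * \<eta> = 1 / (real r ^ 2 * (real r + 1) * (real r + 2))"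
    and M: "10 ^ 6 \<le> M" "1 \<le> M * \<eta>"
  obtains e where "e \<in> F" "(\<eta> * \<rho> / M) ^ (r - 1) \<le> real (card {S \<in> cliques (r + 1) n F. e \<subseteq> S})"
proof -
  interpret edge_critical n F x \<rho> "1 - 1 / real r" \<eta> by (rule C)
  have M0: "M > 0" using M(1) by simp
  have Kf: "card K = r + 1" and Ke: "\<And>u v. u \<in> K \<Longrightarrow> v \<in> K \<Longrightarrow> u \<noteq> v \<Longrightarrow> {u, v} \<in> F"
    using K by (auto simp: cliques_def)
  obtain T where "T \<subseteq> K" "card T = 3" using Kf r obtain_subset_with_card_n[of 3 K] by auto
  then obtain a b c where abc: "a \<in> K" "b \<in> K" "c \<in> K" "a \<noteq> b" "b \<noteq> c" "a \<noteq> c"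
    by (auto simp: card_3_iff)
  have tri: "{a, b} \<in> F" "{b, c} \<in> F" "{a, c} \<in> F" using Ke abc by auto
  have \<rho>0: "0 \<le> \<eta> * \<rho> / M" using eta(1) rho M0 by simp
  \<comment> \<open>For small \<open>\<rho>\<close> the claimed bound is at most 1, and
    \<open>K\<close> itself is enough.\<close>
  consider (small) "\<eta> * \<rho> < M" | (heavy) v where "v < n" "M \<le> \<rho> * w v"
    | (light) "M \<le> \<eta> * \<rho>" "\<And>v. v < n \<Longrightarrow> \<rho> * w v \<le> M"
    by (meson linear not_less)
  then show ?thesis
  proof cases
    case small
    have "K \<in> {S \<in> cliques (r + 1) n F. {a, b} \<subseteq> S}" using K abc by simp
    then have "1 \<le> card {S \<in> cliques (r + 1) n F. {a, b} \<subseteq> S}"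
      using finite_cliques[of "r + 1" n F] card_mono[of "{S \<in> cliques (r + 1) n F. {a, b} \<subseteq> S}" "{K}"] by auto
    moreover have "(\<eta> * \<rho> / M) ^ (r - 1) \<le> 1" using small \<rho>0 M0 by (intro power_le_one) auto
    ultimately show ?thesis using tri by (intro that[of "{a, b}"]) auto
  next
    case heavy
    obtain i j where ij: "{i, j} \<in> F" "16 * \<rho> \<le> M * real (card (N i \<inter> N j))"
      and q2: "2 / 5 < 1 - (1 - 1 / real r) * (1 - 2 * \<eta>)"
      using heavy_vertex_case[OF heavy M tri] by blast
    \<comment> \<open>For \<open>r \<ge> 3\<close> the neighbourhood weight is at least
      \<open>2/3 * 38/40 > 3/5\<close>, leaving less than \<open>2/5\<close> for the light
      vertices.\<close>
    have "r = 2"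
    proof (rule ccontr)
      assume "r \<noteq> 2"
      then have "2 / 3 \<le> 1 - 1 / real r" using r by (simp add: field_simps)
      then have "2 / 3 * (38 / 40) \<le> (1 - 1 / real r) * (1 - 2 * \<eta>)"
        using eta by (intro mult_mono) auto
      then show False using q2 by simp
    qed
    have "(16 * \<rho> / M / real 2) ^ (2 - 1) \<le> real (card {S \<in> cliques (2 + 1) n F. {i, j} \<subseteq> S})"
    proof (rule clique_count_from_extensions[OF ij(1) G])
      show "0 \<le> 16 * \<rho> / M" using rho M0 by simp
      fix s S assume s: "2 \<le> s" "s \<le> 2" and S: "S \<in> cliques s n F" "{i, j} \<subseteq> S"
      have "finite S" "card S = 2" using S s finite_subset[of S "{..<n}"] by (auto simp: cliques_def)
      moreover have "card {i, j} = 2" using edge_less[OF ij(1)] by simp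
      ultimately have "S = {i, j}" using S(2) by (metis card_subset_eq)
      then have "{u \<in> {..<n}. \<forall>v\<in>S. u \<in> N v} = N i \<inter> N j" using N_sub(1)[of i] by auto
      then show "16 * \<rho> / M \<le> real (card {u \<in> {..<n}. \<forall>v\<in>S. u \<in> N v})"
        using ij(2) M0 by (simp add: field_simps)
    qed simp
    moreover have "\<eta> * \<rho> / M \<le> 16 * \<rho> / M / 2"
      using eta rho M0 by (simp add: field_simps)
    ultimately show ?thesis using that[OF ij(1)] \<open>r = 2\<close> by simp
  next
    case light
    define \<beta> where "\<beta> = 1 / (real r ^ 2 * (real r + 1))"
    obtain e where e: "e \<in> F"
      "(\<beta> * \<rho> / (M * real r)) ^ (r - 1) \<le> real (card {S \<in> cliques (r + 1) n F. e \<subseteq> S})"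
      using light_vertices_case[OF refl r K light(2) M0 light(1) eta_eq \<beta>_def] by blast
    have "\<eta> \<le> \<beta> / real r"
    proof -
      have "\<beta> = (real r + 2) * (2 * \<eta>)"
        unfolding \<beta>_def eta_eq by (simp add: add_nonneg_eq_0_iff)
      moreover have "\<eta> * real r \<le> (real r + 2) * (2 * \<eta>)"
        using eta(1) by (simp add: algebra_simps)
      ultimately show ?thesis using r by (simp add: field_simps)
    qed
    then have "\<eta> * (\<rho> / M) \<le> \<beta> / real r * (\<rho> / M)" using rho M0 by (intro mult_right_mono) auto
    then have "\<eta> * \<rho> / M \<le> \<beta> * \<rho> / (M * real r)" by (simp add: field_simps)
    then have "(\<eta> * \<rho> / M) ^ (r - 1) \<le> (\<beta> * \<rho> / (M * real r)) ^ (r - 1)"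
      using \<rho>0 by (intro power_mono)
    then show ?thesis using e by (intro that[of e]) auto
  qed
qed

lemma js_lower_bound:
  assumes r: "2 \<le> r"
  shows "\<exists>c::real. c > 0 \<and>
           (\<forall>n E. simple_graph n E \<longrightarrow>
              (largest_eigenvalue n E)\<^sup>2 > (1 - 1 / real r) * (2 * real (card E)) \<longrightarrow>
              real (js (r + 1) n E) \<ge> c * real (card E) powr ((real r - 1) / 2))"
proof -
  \<comment> \<open>Chosen so that \<open>2\<eta>\<close> is the \<open>\<delta>\<close> of the
    light case, with \<open>\<beta> = (r + 2)\<delta>\<close>; for \<open>r = 2\<close> the product
    in the denominator is 48.\<close>
  define \<eta> where "\<eta> = 1 / (2 * (real r ^ 2 * (real r + 1) * (real r + 2)))"
  define M where "M = 10 ^ 6 + 1 / \<eta>"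
  define q where "q = 1 - 1 / real r"
  have \<eta>0: "\<eta> > 0" using r by (simp add: \<eta>_def)
  have "2 ^ 2 * (2 + 1) * (2 + 2) \<le> real r ^ 2 * (real r + 1) * (real r + 2)"
    using r by (intro mult_mono power_mono) auto
  then have "1 / (2 * (real r ^ 2 * (real r + 1) * (real r + 2))) \<le> 1 / (2 * 48)"
    by (intro divide_left_mono mult_left_mono) auto
  then have \<eta>1: "\<eta> \<le> 1 / 40" by (simp add: \<eta>_def)
  have M: "10 ^ 6 \<le> M" "1 \<le> M * \<eta>" using \<eta>0 by (auto simp: M_def field_simps)
  then have M0: "M > 0" by simp
  have q: "1 / 2 \<le> q" "q \<le> 1" using r by (auto simp: q_def field_simps)
  \<comment> \<open>Comes from \<open>(\<eta> * \<rho> / M) ^ (r - 1)\<close> with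
    \<open>\<rho> \<ge> sqrt (\<eta> * card E)\<close>.\<close>
  let ?c = "(\<eta> * sqrt \<eta> / M) ^ (r - 1)"
  show ?thesis
  proof (intro exI[of _ ?c] conjI allI impI)
    show "?c > 0" using \<eta>0 M0 by simp
    fix n E assume G: "simple_graph n E"
      and big: "(1 - 1 / real r) * (2 * real (card E)) < (largest_eigenvalue n E)\<^sup>2"
    \<comment> \<open>With no vertices the eigenvalue is 0 by convention and the strict hypothesis
      fails.\<close>
    have "n > 0"
    proof (rule ccontr)
      assume "\<not> ?thesis"
      then have "(1 - 1 / real r) * (2 * real (card E)) < 0" using big by (simp add: largest_eigenvalue_def)
      moreover have "0 \<le> (1 - 1 / real r) * (2 * real (card E))" using q unfolding q_def by (intro mult_nonneg_nonneg) auto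
      ultimately show False by simp
    qed
    obtain y where y: "unit_nonneg n y" "\<bar>largest_eigenvalue n E\<bar> \<le> bform n E y y"
      using largest_eigenvalue_le_rayleigh[OF G \<open>n > 0\<close>] by metis
    have "(largest_eigenvalue n E)\<^sup>2 \<le> (bform n E y y)\<^sup>2"
      using y(2) by (simp add: abs_le_square_iff[symmetric])
    then have "q * (2 * real (card E)) < (bform n E y y)\<^sup>2" using big by (simp add: q_def)
    then obtain F x where F: "F \<subseteq> E" "unit_nonneg n x" "edge_critical n F x (bform n F x x) q \<eta>"
      "(bform n F x x)\<^sup>2 > q * (2 * real (card F))" "(bform n F x x)\<^sup>2 \<ge> \<eta> * real (card E)"
      using edge_critical_subgraph[OF G \<open>n > 0\<close> q \<eta>0 \<eta>1 y(1)] by metis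
    define \<rho> where "\<rho> = bform n F x x"
    obtain K where K: "K \<in> cliques (r + 1) n F"
      using clique_exists_of_large_form[OF simple_graph_subset[OF G F(1)] F(2), of r] F(4) r
      unfolding q_def by auto
    have "2 * \<eta> = 1 / (real r ^ 2 * (real r + 1) * (real r + 2))" by (simp add: \<eta>_def)
    then obtain e where e: "e \<in> F" "(\<eta> * \<rho> / M) ^ (r - 1) \<le> real (card {S \<in> cliques (r + 1) n F. e \<subseteq> S})"
      using js_lower_bound_critical[OF r F(3)[unfolded q_def] K _ M] unfolding \<rho>_def by blast
    have \<rho>0: "\<rho> \<ge> 0" unfolding \<rho>_def using F(2) by (intro bform_nonneg) auto
    have "sqrt (\<eta> * real (card E)) \<le> \<rho>" using F(5) \<rho>0 by (intro real_le_lsqrt) (auto simp: \<rho>_def)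
    then have "\<eta> / M * (sqrt \<eta> * sqrt (real (card E))) \<le> \<eta> / M * \<rho>"
      using \<eta>0 M0 by (intro mult_left_mono) (auto simp: real_sqrt_mult)
    then have "(\<eta> * sqrt \<eta> / M * sqrt (real (card E))) ^ (r - 1) \<le> (\<eta> * \<rho> / M) ^ (r - 1)"
      using \<eta>0 M0 by (intro power_mono) auto
    also have "\<dots> \<le> real (js (r + 1) n E)" using e js_mono[OF G F(1) e(1), of "r + 1"] by linarith
    finally show "?c * real (card E) powr ((real r - 1) / 2) \<le> real (js (r + 1) n E)"
      unfolding powr_half_power[OF r] power_mult_distrib[symmetric] .
  qed
qed

section \<open>Tightness: complete graphs\<close>

lemma complete_graph_properties:
  fixes n r :: nat
  defines "E \<equiv> {e. e \<subseteq> {..<n} \<and> card e = 2}"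
  assumes r: "2 \<le> r" and n: "r < n"
  shows "simple_graph n E" "card E = n choose 2"
    "(largest_eigenvalue n E)\<^sup>2 > (1 - 1 / real r) * (2 * real (n choose 2))"
    "real (js (r + 1) n E) \<le> 2 ^ (r - 1) * real (n choose 2) powr ((real r - 1) / 2)"
proof -
  show G: "simple_graph n E" by (auto simp: simple_graph_def E_def)
  show cE: "card E = n choose 2" unfolding E_def using n_subsets[of "{..<n}" 2] by simp
  have m: "2 * real (n choose 2) = real n * (real n - 1)"
  proof -
    have "even (n * (n - 1))" by (cases "n = 0") auto
    then have "2 * (n choose 2) = n * (n - 1)" by (simp add: choose_two)
    then have "2 * real (n choose 2) = real (n * (n - 1))" by (metis of_nat_mult of_nat_numeral)
    then show ?thesis using n by (simp add: of_nat_diff)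
  qed
  have "nbh E i = {..<n} - {i}" if "i < n" for i
    using that by (auto simp: nbh_def E_def card_2_iff)
  \<comment> \<open>The constant vector is an eigenvector for the common degree
    \<open>n - 1\<close>.\<close>
  then have "eigenvalue (adjacency_matrix n E) (real n - 1)"
    using n by (intro eigenvalue_adjacencyI[OF G, of "\<lambda>_. 1" _ 0]) (auto simp: of_nat_diff)
  then have "real n - 1 \<le> largest_eigenvalue n E"
    using finite_eigenvalues_adjacency[of n E] n by (auto simp: largest_eigenvalue_def intro!: Max_ge)
  then have "(real n - 1)\<^sup>2 \<le> (largest_eigenvalue n E)\<^sup>2" using n by (intro power_mono) auto
  \<comment> \<open>Equivalent to \<open>r < n\<close>; this is where the size of the complete graph
    matters.\<close>
  moreover have "(1 - 1 / real r) * real n < real n - 1"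
    using n r by (simp add: field_simps)
  then have "(1 - 1 / real r) * real n * (real n - 1) < (real n - 1) * (real n - 1)"
    using n r by (intro mult_strict_right_mono) auto
  ultimately show "(largest_eigenvalue n E)\<^sup>2 > (1 - 1 / real r) * (2 * real (n choose 2))"
    unfolding m by (simp add: power2_eq_square mult_ac)
  have "card {S \<in> cliques (r + 1) n E. e \<subseteq> S} \<le> n ^ (r - 1)" if e: "e \<in> E" for e
  proof -
    \<comment> \<open>Removing \<open>e\<close> maps these cliques injectively to sets of
      \<open>r - 1\<close> vertices.\<close>
    have "card {S \<in> cliques (r + 1) n E. e \<subseteq> S} \<le> card {T. T \<subseteq> {..<n} \<and> card T = r - 1}"
    proof (rule card_inj_on_le)
      show "inj_on (\<lambda>S. S - e) {S \<in> cliques (r + 1) n E. e \<subseteq> S}" by (auto simp: inj_on_def)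
      have "finite e" "card e = 2" using e finite_subset[of e "{..<n}"] by (auto simp: E_def)
      then show "(\<lambda>S. S - e) ` {S \<in> cliques (r + 1) n E. e \<subseteq> S} \<subseteq> {T. T \<subseteq> {..<n} \<and> card T = r - 1}"
        by (auto simp: cliques_def card_Diff_subset)
    qed simp
    also have "\<dots> = n choose (r - 1)" using n_subsets[of "{..<n}" "r - 1"] by simp
    also have "\<dots> \<le> n ^ (r - 1)" using n by (intro binomial_le_pow) simp
    finally show ?thesis .
  qed
  moreover have "E \<noteq> {}" using cE n r by (metis card.empty zero_less_binomial le_trans less_imp_le less_irrefl)
  ultimately have "js (r + 1) n E \<le> n ^ (r - 1)"
    using simple_graph_finite[OF G] by (auto simp: js_def)
  then have "real (js (r + 1) n E) \<le> real n ^ (r - 1)" by (metis of_nat_le_iff of_nat_power)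
  also have "real n \<le> 2 * sqrt (real (n choose 2))"
  proof -
    have "real n * 2 \<le> real n * (2 * (real n - 1))" using n r by (intro mult_left_mono) auto
    then have "real n ^ 2 \<le> 4 * real (n choose 2)" using m by (simp add: power2_eq_square algebra_simps)
    then have "real n \<le> sqrt (4 * real (n choose 2))" by (intro real_le_rsqrt)
    then show ?thesis by (simp add: real_sqrt_mult)
  qed
  then have "real n ^ (r - 1) \<le> (2 * sqrt (real (n choose 2))) ^ (r - 1)" by (intro power_mono) auto
  finally show "real (js (r + 1) n E) \<le> 2 ^ (r - 1) * real (n choose 2) powr ((real r - 1) / 2)"
    unfolding powr_half_power[OF r] by (simp add: power_mult_distrib)
qed

theorem theorem3p2:
  fixes r :: nat
  assumes "r \<ge> 2"
  shows "(\<exists>c::real. c > 0 \<and>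
           (\<forall>n E. simple_graph n E \<longrightarrow>
              (largest_eigenvalue n E)\<^sup>2 > (1 - 1 / real r) * (2 * real (card E)) \<longrightarrow>
              real (js (r + 1) n E) \<ge> c * real (card E) powr ((real r - 1) / 2)))
       \<and> (\<exists>C::real. infinite {m::nat. \<exists>n E. simple_graph n E \<and> card E = m \<and>
              (largest_eigenvalue n E)\<^sup>2 > (1 - 1 / real r) * (2 * real m) \<and>
              real (js (r + 1) n E) \<le> C * real m powr ((real r - 1) / 2)})"
proof (intro conjI js_lower_bound[OF assms] exI[of _ "2 ^ (r - 1)"])
  show "infinite {m::nat. \<exists>n E. simple_graph n E \<and> card E = m \<and>
              (largest_eigenvalue n E)\<^sup>2 > (1 - 1 / real r) * (2 * real m) \<and>
              real (js (r + 1) n E) \<le> 2 ^ (r - 1) * real m powr ((real r - 1) / 2)}"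
    unfolding infinite_nat_iff_unbounded
  proof
    fix k :: nat
    let ?n = "k + r + 2"
    \<comment> \<open>Pascal's rule; the first summand already exceeds \<open>k\<close>.\<close>
    have "?n choose 2 = (k + r + 1) + ((k + r + 1) choose 2)"
      using binomial_Suc_Suc[of "k + r + 1" 1] by (simp add: numeral_2_eq_2)
    then have "k < ?n choose 2" by simp
    moreover have "r < ?n" by simp
    ultimately show "\<exists>m>k. m \<in> {m::nat. \<exists>n E. simple_graph n E \<and> card E = m \<and>
              (largest_eigenvalue n E)\<^sup>2 > (1 - 1 / real r) * (2 * real m) \<and>
              real (js (r + 1) n E) \<le> 2 ^ (r - 1) * real m powr ((real r - 1) / 2)}"
      using complete_graph_properties[OF assms, of ?n] by blast
  qed
qed

end
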